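(* Let $V:\mathbb{R}^N\to\mathbb{R}$ satisfy $V\in C^\infty(\mathbb{R}^N)$ and $\partial_x^\alpha V\in L^\infty(\mathbb{R}^N)$ for every multi-index $\alpha\in\mathbb{N}^N$ with $|\alpha|\geq 2$. Let $b>0$, $x_0,\dot{x}_0\in\mathbb{R}^N$ and let $\psi_0\in\mathcal{S}$ be defined by $$\psi_0(x):=\frac{b^{N/4}}{C_N}\,e^{-\frac{b}{2}\|x-x_0\|^2+i\langle \dot{x}_0,x-x_0\rangle},\qquad C_N:=\left(\int_{\mathbb{R}^N}e^{-\|y\|^2}dy\right)^{1/2}.$$ Let $\psi_f\in\mathcal{S}$ be a state that does not have a Gaussian profile, in the sense that for every $\gamma\in\mathbb{R}^N$ and every symmetric positive definite matrix $S\in\mathcal{M}_N(\mathbb{R})$, $$|\psi_f(\cdot)|\neq\frac{\det(S)^{1/4}}{C_N}\,e^{-\frac12\|\sqrt{S}(\cdot-\gamma)\|^2}$$ (as elements of $L^2(\mathbb{R}^N)$). Then there exist $T^{**}>0$, depending only on $\|V''\|_\infty$, $\|V^{(3)}\|_\infty$, $b$ and $\psi_f$, and $\delta>0$, depending only on $\|V''\|_\infty$, $b$ and $\psi_f$, such that for every piecewise continuous $E:[0,T^{**}]\to\mathbb{R}^N$, the solution $\psi$ of $$i\partial_t\psi(t,x)=\Big(-\tfrac12\Delta+V(x)-\langle E(t),x\rangle\Big)\psi(t,x),\qquad \psi(0,x)=\psi_0(x),$$ satisfies $$\|\psi(t)-\psi_f\|_{L^2(\mathbb{R}^N)}>\delta\qquad\text{for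 all } t\in[0,T^{**}].$$
   Context: $N\geq 1$ is a fixed integer (constants may depend on $N$). $\mathcal{S}$ is the unit sphere of $L^2(\mathbb{R}^N,\mathbb{C})$; $\langle\cdot,\cdot\rangle$ and $\|\cdot\|$ are the Euclidean scalar product and norm on $\mathbb{R}^N$; $\mathcal{M}_N(\mathbb{R})$ is the set of real $N\times N$ matrices. $V''$ is the Hessian matrix of $V$ and $V^{(3)}$ its third derivative; $\|V''\|_\infty$ and $\|V^{(3)}\|_\infty$ are the suprema over $\mathbb{R}^N$ of the operator norm of $V''(x)$ and of the norm of the trilinear form $V^{(3)}(x)$. Piecewise continuous means continuous except at finitely many points, where one-sided limits exist. Notion of solution: for $V$ as in the claim and $E\in L^\infty_{loc}(\mathbb{R},\mathbb{R}^N)$ (a control defined on a bounded interval is extended, e.g. by $0$), it is a known result (Fujiwara) that there is a strongly continuous map $(t,s)\in\mathbb{R}^2\mapsto U(t,s)$ with values in the unitary operators of $L^2(\mathbb{R}^N,\mathbb{C})$, such that $U(t,t)=\mathrm{Id}$, $U(t,\tau)U(\tau,s)=U(t,s)$, $U(t,s)^*=U(s,t)^{-1}$ hold as recalled in the literature for unitary propagators, and such that for every $\varphi\in L^2(\mathbb{R}^N,\mathbb{C})$, $\psi(t)=U(t,s)\varphi$ solves $i\partial_t\psi=(-\frac12\Delta+V(x)-\langle E(t),x\rangle)\psi$ with $\psi(s)=\varphi$. The solution $\psi$ in the claim is $\psi(t)=U(t,0)\psi_0$. *)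

theory Defs
  imports "HOL-Analysis.Analysis"
begin

section \<open>Smooth functions\<close>

text \<open>
  A partial derivative \<open>\<partial>\<^sup>\<alpha> f\<close> is indexed by a list of coordinate directions; its order is the length
  of the list, and the multi-index \<open>\<alpha>\<close> counts the occurrences of each coordinate. For the smooth
  functions considered below the ordering of the list is immaterial.
\<close>

primrec partials ::
    "'n::finite list \<Rightarrow> (real^'n \<Rightarrow> 'b::real_normed_vector) \<Rightarrow> real^'n \<Rightarrow> 'b" where
  "partials [] f = f"
| "partials (i # \<alpha>) f = (\<lambda>x. frechet_derivative (partials \<alpha> f) (at x) (axis i 1))"

definition smooth :: "(real^'n::finite \<Rightarrow> 'b::real_normed_vector) \<Rightarrow> bool" where
  "smooth f \<longleftrightarrow> (\<forall>\<alpha> x. partials \<alpha> f differentiable (at x))"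

definition test_function :: "(real^'n::finite \<Rightarrow> complex) \<Rightarrow> bool" where
  "test_function \<eta> \<longleftrightarrow> smooth \<eta> \<and> compact (closure {x. \<eta> x \<noteq> 0})"

text \<open>
  Since the derivatives of a smooth function are continuous, their essential boundedness is plain
  boundedness.
\<close>

definition admissible_potential :: "(real^'n::finite \<Rightarrow> real) \<Rightarrow> bool" where
  "admissible_potential V \<longleftrightarrow>
     smooth V \<and> (\<forall>\<alpha>. 2 \<le> length \<alpha> \<longrightarrow> bounded (range (partials \<alpha> V)))"

definition hessian :: "(real^'n::finite \<Rightarrow> real) \<Rightarrow> real^'n \<Rightarrow> real^'n^'n" where
  "hessian V x = (\<chi> i j. partials [i, j] V x)"

definition third_derivative ::
    "(real^'n::finite \<Rightarrow> real) \<Rightarrow> real^'n \<Rightarrow> real^'n \<Rightarrow> real^'n \<Rightarrow> real^'n \<Rightarrow> real" where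
  "third_derivative V x u v w =
     (\<Sum>i\<in>UNIV. \<Sum>j\<in>UNIV. \<Sum>k\<in>UNIV. partials [i, j, k] V x * u $ i * v $ j * w $ k)"

definition trilinear_norm ::
    "(real^'n::finite \<Rightarrow> real^'n \<Rightarrow> real^'n \<Rightarrow> real) \<Rightarrow> real" where
  "trilinear_norm B = Sup {\<bar>B u v w\<bar> | u v w. norm u \<le> 1 \<and> norm v \<le> 1 \<and> norm w \<le> 1}"

definition hessian_sup_norm :: "(real^'n::finite \<Rightarrow> real) \<Rightarrow> real" where
  "hessian_sup_norm V = (SUP x. onorm (\<lambda>v. hessian V x *v v))"

definition third_derivative_sup_norm :: "(real^'n::finite \<Rightarrow> real) \<Rightarrow> real" where
  "third_derivative_sup_norm V = (SUP x. trilinear_norm (third_derivative V x))"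

section \<open>The space of square integrable functions\<close>

text \<open>
  Elements of \<open>L\<^sup>2(\<real>\<^sup>N, \<complex>)\<close> are represented by functions; equality in \<open>L\<^sup>2\<close> is equality almost
  everywhere.
\<close>

definition L2 :: "(real^'n::finite \<Rightarrow> complex) set" where
  "L2 = {f. f \<in> borel_measurable lborel \<and> integrable lborel (\<lambda>x. (norm (f x))\<^sup>2)}"

definition L2_inner ::
    "(real^'n::finite \<Rightarrow> complex) \<Rightarrow> (real^'n \<Rightarrow> complex) \<Rightarrow> complex" where
  "L2_inner f g = (LINT x|lborel. cnj (f x) * g x)"

definition L2_norm :: "(real^'n::finite \<Rightarrow> complex) \<Rightarrow> real" where
  "L2_norm f = sqrt (LINT x|lborel. (norm (f x))\<^sup>2)"

definition L2_sphere :: "(real^'n::finite \<Rightarrow> complex) set" where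
  "L2_sphere = {f \<in> L2. L2_norm f = 1}"

definition L2_eq :: "(real^'n::finite \<Rightarrow> complex) \<Rightarrow> (real^'n \<Rightarrow> complex) \<Rightarrow> bool" where
  "L2_eq f g \<longleftrightarrow> (AE x in lborel. f x = g x)"

section \<open>Gaussian states\<close>

definition gauss_const :: "'n::finite itself \<Rightarrow> real" where
  "gauss_const (n :: 'n itself) = sqrt (LINT y::real^'n|lborel. exp (- (norm y)\<^sup>2))"

definition gaussian_state :: "real \<Rightarrow> real^'n::finite \<Rightarrow> real^'n \<Rightarrow> real^'n \<Rightarrow> complex" where
  "gaussian_state b x0 v0 x =
     complex_of_real (b powr (real CARD('n) / 4) / gauss_const TYPE('n)) *
     exp (complex_of_real (- (b / 2) * (norm (x - x0))\<^sup>2)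
          + \<i> * complex_of_real (v0 \<bullet> (x - x0)))"

definition sym_pos_semidef :: "real^'n::finite^'n \<Rightarrow> bool" where
  "sym_pos_semidef S \<longleftrightarrow> transpose S = S \<and> (\<forall>x. 0 \<le> x \<bullet> (S *v x))"

definition sym_pos_def :: "real^'n::finite^'n \<Rightarrow> bool" where
  "sym_pos_def S \<longleftrightarrow> transpose S = S \<and> (\<forall>x. x \<noteq> 0 \<longrightarrow> 0 < x \<bullet> (S *v x))"

definition matrix_sqrt :: "real^'n::finite^'n \<Rightarrow> real^'n^'n" where
  "matrix_sqrt S = (THE R. sym_pos_semidef R \<and> R ** R = S)"

definition gaussian_profile :: "real^'n::finite^'n \<Rightarrow> real^'n \<Rightarrow> real^'n \<Rightarrow> real" where
  "gaussian_profile S \<gamma> x =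
     det S powr (1 / 4) / gauss_const TYPE('n) * exp (- (1 / 2) * (norm (matrix_sqrt S *v (x - \<gamma>)))\<^sup>2)"

definition has_gaussian_profile :: "(real^'n::finite \<Rightarrow> complex) \<Rightarrow> bool" where
  "has_gaussian_profile \<phi> \<longleftrightarrow>
     (\<exists>\<gamma> S. sym_pos_def S \<and> (AE x in lborel. norm (\<phi> x) = gaussian_profile S \<gamma> x))"

section \<open>The controlled Schroedinger equation\<close>

definition laplacian :: "(real^'n::finite \<Rightarrow> complex) \<Rightarrow> real^'n \<Rightarrow> complex" where
  "laplacian f x = (\<Sum>i\<in>UNIV. partials [i, i] f x)"

definition hamiltonian ::
    "(real^'n::finite \<Rightarrow> real) \<Rightarrow> real^'n \<Rightarrow> (real^'n \<Rightarrow> complex) \<Rightarrow> real^'n \<Rightarrow> complex" where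
  "hamiltonian V e f x = - (1 / 2) * laplacian f x + complex_of_real (V x - e \<bullet> x) * f x"

text \<open>
  For initial data that are merely in \<open>L\<^sup>2\<close> the equation \<open>i \<partial>\<^sub>t \<psi> = H(t) \<psi>\<close> holds in the sense of
  distributions: it is tested against smooth, compactly supported functions, the symmetric operator
  \<open>H(t)\<close> is moved onto the test function, and the equation is integrated in time because the control
  may jump. The interval integral is oriented, so \<open>t < s\<close> is covered.
\<close>

definition weak_solution ::
    "(real^'n::finite \<Rightarrow> real) \<Rightarrow> (real \<Rightarrow> real^'n) \<Rightarrow> real \<Rightarrow> (real \<Rightarrow> real^'n \<Rightarrow> complex) \<Rightarrow> bool" where
  "weak_solution V E s \<psi> \<longleftrightarrow>
     (\<forall>\<eta> t. test_function \<eta> \<longrightarrow>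
        interval_lebesgue_integrable lborel (ereal s) (ereal t)
          (\<lambda>\<tau>. L2_inner (hamiltonian V (E \<tau>) \<eta>) (\<psi> \<tau>)) \<and>
        \<i> * (L2_inner \<eta> (\<psi> t) - L2_inner \<eta> (\<psi> s)) =
          (LBINT \<tau>=ereal s..ereal t. L2_inner (hamiltonian V (E \<tau>) \<eta>) (\<psi> \<tau>)))"

text \<open>
  Unitarity: a linear, inner product preserving bijection of \<open>L\<^sup>2\<close>. Compatibility with equality
  almost everywhere says that the operator acts on \<open>L\<^sup>2\<close> classes.
\<close>

definition unitary_operator ::
    "((real^'n::finite \<Rightarrow> complex) \<Rightarrow> real^'n \<Rightarrow> complex) \<Rightarrow> bool" where
  "unitary_operator A \<longleftrightarrow>
     (\<forall>f\<in>L2. A f \<in> L2) \<and>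
     (\<forall>f\<in>L2. \<forall>g\<in>L2. L2_eq f g \<longrightarrow> L2_eq (A f) (A g)) \<and>
     (\<forall>f\<in>L2. \<forall>g\<in>L2. \<forall>c d. L2_eq (A (\<lambda>x. c * f x + d * g x)) (\<lambda>x. c * A f x + d * A g x)) \<and>
     (\<forall>f\<in>L2. \<forall>g\<in>L2. L2_inner (A f) (A g) = L2_inner f g) \<and>
     (\<forall>g\<in>L2. \<exists>f\<in>L2. L2_eq (A f) g)"

text \<open>
  The adjoint relation \<open>U(t,s)\<^sup>* = U(t,s)\<^sup>-\<^sup>1 = U(s,t)\<close> follows from unitarity, the composition law and
  \<open>U(t,t) = Id\<close>.
\<close>

definition schroedinger_propagator ::
    "(real^'n::finite \<Rightarrow> real) \<Rightarrow> (real \<Rightarrow> real^'n) \<Rightarrow>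
      (real \<Rightarrow> real \<Rightarrow> (real^'n \<Rightarrow> complex) \<Rightarrow> real^'n \<Rightarrow> complex) \<Rightarrow> bool" where
  "schroedinger_propagator V E U \<longleftrightarrow>
     (\<forall>t s. unitary_operator (U t s)) \<and>
     (\<forall>f\<in>L2. \<forall>t s. ((\<lambda>(t', s'). L2_norm (\<lambda>x. U t' s' f x - U t s f x)) \<longlongrightarrow> 0) (at (t, s))) \<and>
     (\<forall>f\<in>L2. \<forall>t. L2_eq (U t t f) f) \<and>
     (\<forall>f\<in>L2. \<forall>t \<tau> s. L2_eq (U t \<tau> (U \<tau> s f)) (U t s f)) \<and>
     (\<forall>f\<in>L2. \<forall>s. weak_solution V E s (\<lambda>t. U t s f))"

definition piecewise_continuous :: "real \<Rightarrow> real \<Rightarrow> (real \<Rightarrow> real^'n::finite) \<Rightarrow> bool" where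
  "piecewise_continuous a b E \<longleftrightarrow>
     (\<exists>F. finite F \<and>
        (\<forall>t\<in>{a..b} - F. continuous (at t within {a..b}) E) \<and>
        (\<forall>t\<in>F \<inter> {a..b}. (a < t \<longrightarrow> (\<exists>l. (E \<longlongrightarrow> l) (at_left t))) \<and>
                            (t < b \<longrightarrow> (\<exists>l. (E \<longlongrightarrow> l) (at_right t)))))"

end

theory Submission
  imports Defs "HOL-Probability.Distributions"
begin

text \<open>
  Over a short time no control can do more to a Gaussian wave packet than carry it along. In a frame that
  follows the classical trajectory \<open>q' = p\<close>, \<open>p' = E - \<nabla>V(q)\<close>, and after removal of the phase
  \<open>\<theta> + p \<bullet> x\<close>, the control disappears from the Schroedinger equation. What acts on the profile is
  the dispersion \<open>-\<Delta>/2\<close> and the error of the affine approximation of \<open>V\<close> at the centre, which is quadratic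
  in the distance with a constant that depends on \<open>\<parallel>V''\<parallel>\<^sub>\<infinity>\<close> only. Hence the solution stays close
  to translates of the initial Gaussian, up to a phase, for a time that does not depend on the control.

  It therefore suffices to compare the solution with the initial profile, moved but not deformed. The
  moving packet \<open>\<eta>\<close> violates the equation by a residual that is explicit (\<open>packet_residual\<close>) and bounded in
  \<open>L\<^sup>2\<close> uniformly in the control (\<open>packet_residual_le\<close>). The overlap \<open>\<langle>\<eta>(t), \<psi>(t)\<rangle>\<close> then drifts at most
  linearly in time (\<open>overlap_drift\<close>), and because \<open>\<eta>\<close> and \<open>\<psi>\<close> have constant norms, the same holds for the
  squared distance between them (\<open>solution_near_gaussian_packets\<close>). Two devices keep the analysis elementary.
  The profile is a smooth function of compact support close to the Gaussian, so the packet is an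
  admissible test function in the weak form of the equation at every time. The classical trajectory is
  replaced by a late Picard iterate (\<open>approximate_trajectory\<close>): an error of size \<open>1\<close> in the position at which
  the force is evaluated only changes the constant in the bound on the residual.

  On the other side, a target state without Gaussian profile has positive distance to all states whose
  modulus is a translate of the initial one (\<open>positive_distance_to_gauss_translates\<close>); translates cannot escape
  to infinity while approaching a limit in \<open>L\<^sup>2\<close>, because their mutual distances determine the distances
  of their centres. Half of this distance is the required \<open>\<delta>\<close>, and the time is chosen so that the
  solution cannot cover the other half.
\<close>

section \<open>The space of square integrable functions\<close>

lemma L2I:
  assumes "f \<in> borel_measurable lborel" "integrable lborel (\<lambda>x. (norm (f x))\<^sup>2)"
  shows "f \<in> L2"
  using assms by (simp add: L2_def)

lemma L2_measurable: "f \<in> L2 \<Longrightarrow> f \<in> borel_measurable lborel"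
  by (simp add: L2_def)

lemma L2_integrable: "f \<in> L2 \<Longrightarrow> integrable lborel (\<lambda>x. (norm (f x))\<^sup>2)"
  by (simp add: L2_def)

lemma L2_dominated:
  assumes "f \<in> L2" "g \<in> borel_measurable lborel" "\<And>x. norm (g x) \<le> norm (f x)"
  shows "g \<in> L2"
proof (rule L2I)
  show "integrable lborel (\<lambda>x. (norm (g x))\<^sup>2)"
    by (rule Bochner_Integration.integrable_bound[OF L2_integrable[OF assms(1)]])
      (use assms(2,3) in \<open>auto intro!: AE_I2 power_mono\<close>)
qed (fact assms(2))

lemma L2_add:
  assumes "f \<in> L2" "g \<in> L2" shows "(\<lambda>x. f x + g x) \<in> L2"
proof (rule L2I)
  note [measurable] = L2_measurable[OF assms(1)] L2_measurable[OF assms(2)]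
  show "(\<lambda>x. f x + g x) \<in> borel_measurable lborel" by measurable
  show "integrable lborel (\<lambda>x. (norm (f x + g x))\<^sup>2)"
  proof (rule Bochner_Integration.integrable_bound)
    show "integrable lborel (\<lambda>x. 2 * (norm (f x))\<^sup>2 + 2 * (norm (g x))\<^sup>2)"
      by (intro Bochner_Integration.integrable_add integrable_mult_right L2_integrable assms)
    have "(norm (f x + g x))\<^sup>2 \<le> 2 * (norm (f x))\<^sup>2 + 2 * (norm (g x))\<^sup>2" for x
    proof -
      have "(norm (f x + g x))\<^sup>2 \<le> (norm (f x) + norm (g x))\<^sup>2"
        by (intro power_mono norm_triangle_ineq) auto
      also have "\<dots> \<le> 2 * (norm (f x))\<^sup>2 + 2 * (norm (g x))\<^sup>2"
        using zero_le_power2[of "norm (f x) - norm (g x)"]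
        by (simp add: power2_eq_square algebra_simps)
      finally show ?thesis .
    qed
    then show "AE x in lborel. norm ((norm (f x + g x))\<^sup>2)
        \<le> norm (2 * (norm (f x))\<^sup>2 + 2 * (norm (g x))\<^sup>2)"
      by (intro AE_I2) (simp add: abs_of_nonneg)
  qed measurable
qed

lemma L2_cmult: "f \<in> L2 \<Longrightarrow> (\<lambda>x. c * f x) \<in> L2"
  by (auto simp: L2_def norm_mult power_mult_distrib)

lemma L2_diff: "f \<in> L2 \<Longrightarrow> g \<in> L2 \<Longrightarrow> (\<lambda>x. f x - g x) \<in> L2"
  using L2_add[of f "\<lambda>x. (-1) * g x"] L2_cmult[of g "-1"] by simp

lemma L2_norm_nonneg: "0 \<le> L2_norm f"
  by (simp add: L2_norm_def)

lemma L2_norm_power2: "(L2_norm f)\<^sup>2 = (LINT x|lborel. (norm (f x))\<^sup>2)"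
  by (simp add: L2_norm_def)

lemma L2_norm_cmult: "L2_norm (\<lambda>x. c * f x) = norm c * L2_norm f"
  by (simp add: L2_norm_def norm_mult power_mult_distrib real_sqrt_mult)

lemma L2_norm_mono:
  assumes "f \<in> L2" "g \<in> borel_measurable lborel" "\<And>x. norm (g x) \<le> norm (f x)"
  shows "L2_norm g \<le> L2_norm f"
  unfolding L2_norm_def
  by (intro real_sqrt_le_mono integral_mono L2_integrable L2_dominated[OF assms] assms(1)
      power_mono assms(3)) auto

lemma L2_norm_minus_commute: "L2_norm (\<lambda>x. f x - g x) = L2_norm (\<lambda>x. g x - f x)"
  by (simp add: L2_norm_def norm_minus_commute)

lemma L2_norm_cong_AE:
  assumes "f \<in> borel_measurable lborel" "g \<in> borel_measurable lborel"
    "AE x in lborel. norm (f x) = norm (g x)"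
  shows "L2_norm f = L2_norm g"
proof -
  have "(LINT x|lborel. (norm (f x))\<^sup>2) = (LINT x|lborel. (norm (g x))\<^sup>2)"
    by (rule integral_cong_AE) (use assms in auto)
  then show ?thesis by (simp add: L2_norm_def)
qed

lemma L2_norm_eq_0_AE:
  assumes "f \<in> L2" "L2_norm f = 0"
  shows "AE x in lborel. f x = 0"
proof -
  have "(LINT x|lborel. (norm (f x))\<^sup>2) = 0"
    using assms(2) L2_norm_power2[of f] by simp
  then show ?thesis
    using integral_nonneg_eq_0_iff_AE[OF L2_integrable[OF assms(1)]] by simp
qed

text \<open>
  Cauchy--Schwarz, from the weighted inequality \<open>2uv \<le> cu\<^sup>2 + v\<^sup>2/c\<close> with the optimal weight
  \<open>c = \<parallel>g\<parallel>/\<parallel>f\<parallel>\<close>. The degenerate case, where this weight does not exist, is the one in which one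
  factor vanishes almost everywhere.
\<close>

lemma norm_integral_product_le:
  assumes f: "f \<in> L2" and g: "g \<in> L2"
  shows "integrable lborel (\<lambda>x. norm (f x) * norm (g x))" (is "integrable _ ?h")
    and "(LINT x|lborel. norm (f x) * norm (g x)) \<le> L2_norm f * L2_norm g"
proof -
  note [measurable] = L2_measurable[OF f] L2_measurable[OF g]
  note i = L2_integrable[OF f] L2_integrable[OF g]
  have am: "u * v \<le> (c * u\<^sup>2 + v\<^sup>2 / c) / 2" if "c > 0" for u v c :: real
  proof -
    have "(c * u - v)\<^sup>2 \<ge> 0" by simp
    then have "2 * c * (u * v) \<le> c\<^sup>2 * u\<^sup>2 + v\<^sup>2" by (simp add: power2_eq_square algebra_simps)
    then show ?thesis using that by (simp add: field_simps power2_eq_square)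
  qed
  show int: "integrable lborel ?h"
  proof (rule Bochner_Integration.integrable_bound)
    show "integrable lborel (\<lambda>x. (1 * (norm (f x))\<^sup>2 + (norm (g x))\<^sup>2 / 1) / 2)"
      using i by auto
    show "AE x in lborel. norm (?h x) \<le> norm ((1 * (norm (f x))\<^sup>2 + (norm (g x))\<^sup>2 / 1) / 2)"
      using am[of 1] by (intro AE_I2) (simp add: abs_of_nonneg)
  qed measurable
  show "(LINT x|lborel. ?h x) \<le> L2_norm f * L2_norm g"
  proof (cases "L2_norm f = 0 \<or> L2_norm g = 0")
    case True
    then have "AE x in lborel. ?h x = 0"
    proof
      assume "L2_norm f = 0" from L2_norm_eq_0_AE[OF f this] show ?thesis by eventually_elim simp
    next
      assume "L2_norm g = 0" from L2_norm_eq_0_AE[OF g this] show ?thesis by eventually_elim simp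
    qed
    then have "(LINT x|lborel. ?h x) = (LINT x|(lborel::(real^'a) measure). 0)"
      by (intro integral_cong_AE) auto
    then show ?thesis by (simp add: L2_norm_nonneg)
  next
    case False
    define a where "a = L2_norm f" define b where "b = L2_norm g"
    have ab: "a > 0" "b > 0"
      using False L2_norm_nonneg[of f] L2_norm_nonneg[of g] by (auto simp: a_def b_def)
    have "(LINT x|lborel. ?h x)
        \<le> (LINT x|lborel. (b / a * (norm (f x))\<^sup>2 + (norm (g x))\<^sup>2 / (b / a)) / 2)"
    proof (rule integral_mono[OF int])
      show "integrable lborel (\<lambda>x. (b / a * (norm (f x))\<^sup>2 + (norm (g x))\<^sup>2 / (b / a)) / 2)"
        using i by auto
      show "?h x \<le> (b / a * (norm (f x))\<^sup>2 + (norm (g x))\<^sup>2 / (b / a)) / 2" for x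
        by (rule am) (use ab in auto)
    qed
    also have "\<dots> = (b / a * a\<^sup>2 + b\<^sup>2 / (b / a)) / 2"
      using i by (simp add: a_def b_def L2_norm_power2 add_divide_distrib)
    also have "\<dots> = a * b" using ab by (simp add: field_simps power2_eq_square)
    finally show ?thesis by (simp add: a_def b_def)
  qed
qed

lemma L2_inner_integrable:
  assumes "f \<in> L2" "g \<in> L2"
  shows "integrable lborel (\<lambda>x. cnj (f x) * g x)"
proof (rule Bochner_Integration.integrable_bound[OF norm_integral_product_le(1)[OF assms]])
  note [measurable] = L2_measurable[OF assms(1)] L2_measurable[OF assms(2)]
  show "(\<lambda>x. cnj (f x) * g x) \<in> borel_measurable lborel"
    by (intro borel_measurable_times borel_measurable_continuous_on[where f=cnj]) (auto intro: continuous_intros)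
qed (auto simp: norm_mult)

lemma L2_inner_Cauchy_Schwarz:
  assumes "f \<in> L2" "g \<in> L2"
  shows "norm (L2_inner f g) \<le> L2_norm f * L2_norm g"
proof -
  have "norm (L2_inner f g) \<le> (LINT x|lborel. norm (cnj (f x) * g x))"
    unfolding L2_inner_def by (rule integral_norm_bound)
  also have "\<dots> = (LINT x|lborel. norm (f x) * norm (g x))" by (simp add: norm_mult)
  also have "\<dots> \<le> L2_norm f * L2_norm g" by (rule norm_integral_product_le(2)[OF assms])
  finally show ?thesis .
qed

lemma L2_inner_diff_left:
  "f \<in> L2 \<Longrightarrow> f' \<in> L2 \<Longrightarrow> g \<in> L2 \<Longrightarrow>
    L2_inner (\<lambda>x. f x - f' x) g = L2_inner f g - L2_inner f' g"
  by (simp add: L2_inner_def ring_distribs L2_inner_integrable)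

lemma L2_inner_diff_right:
  "f \<in> L2 \<Longrightarrow> g \<in> L2 \<Longrightarrow> g' \<in> L2 \<Longrightarrow>
    L2_inner f (\<lambda>x. g x - g' x) = L2_inner f g - L2_inner f g'"
  by (simp add: L2_inner_def ring_distribs L2_inner_integrable)

lemma L2_inner_cmult_left: "L2_inner (\<lambda>x. c * f x) g = cnj c * L2_inner f g"
  by (simp add: L2_inner_def mult.assoc)

lemma L2_inner_self: "L2_inner f f = complex_of_real ((L2_norm f)\<^sup>2)"
proof -
  have "L2_inner f f = (LINT x|lborel. complex_of_real ((norm (f x))\<^sup>2))"
    unfolding L2_inner_def
    by (intro Bochner_Integration.integral_cong) (auto simp: complex_norm_square mult.commute simp del: of_real_power)
  then show ?thesis by (simp add: L2_norm_power2 del: of_real_power)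
qed

text \<open>
  This identity turns a lower bound on an overlap into an upper bound on a distance.
\<close>

lemma L2_norm_diff_power2:
  assumes f: "f \<in> L2" and g: "g \<in> L2"
  shows "(L2_norm (\<lambda>x. f x - g x))\<^sup>2 = (L2_norm f)\<^sup>2 + (L2_norm g)\<^sup>2 - 2 * Re (L2_inner f g)"
proof -
  have e: "(norm (u - v))\<^sup>2 = (norm u)\<^sup>2 + (norm v)\<^sup>2 - 2 * Re (cnj u * v)" for u v :: complex
    by (simp only: cmod_power2) (simp add: power2_eq_square algebra_simps)
  have "(L2_norm (\<lambda>x. f x - g x))\<^sup>2
      = (LINT x|lborel. (norm (f x))\<^sup>2 + (norm (g x))\<^sup>2 - 2 * Re (cnj (f x) * g x))"
    by (simp add: L2_norm_power2 e)
  also have "\<dots> = (L2_norm f)\<^sup>2 + (L2_norm g)\<^sup>2 - 2 * (LINT x|lborel. Re (cnj (f x) * g x))"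
    using L2_integrable[OF f] L2_integrable[OF g] integrable_Re[OF L2_inner_integrable[OF f g]]
    by (simp add: L2_norm_power2 del: times_complex.sel)
  also have "(LINT x|lborel. Re (cnj (f x) * g x)) = Re (L2_inner f g)"
    unfolding L2_inner_def by (rule integral_Re[OF L2_inner_integrable[OF f g]])
  finally show ?thesis .
qed

lemma L2_norm_triangle:
  assumes f: "f \<in> L2" and g: "g \<in> L2"
  shows "L2_norm (\<lambda>x. f x - g x) \<le> L2_norm f + L2_norm g"
proof (rule power2_le_imp_le)
  have "- Re (L2_inner f g) \<le> L2_norm f * L2_norm g"
    using L2_inner_Cauchy_Schwarz[OF f g] abs_Re_le_cmod[of "L2_inner f g"] by linarith
  then show "(L2_norm (\<lambda>x. f x - g x))\<^sup>2 \<le> (L2_norm f + L2_norm g)\<^sup>2"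
    unfolding L2_norm_diff_power2[OF f g] by (simp add: power2_eq_square algebra_simps)
  show "0 \<le> L2_norm f + L2_norm g" by (simp add: L2_norm_nonneg)
qed

lemma L2_dist_triangle:
  assumes "f \<in> L2" "g \<in> L2" "h \<in> L2"
  shows "L2_norm (\<lambda>x. f x - h x) \<le> L2_norm (\<lambda>x. f x - g x) + L2_norm (\<lambda>x. g x - h x)"
proof -
  have "L2_norm (\<lambda>x. f x - h x) = L2_norm (\<lambda>x. (f x - g x) - (h x - g x))" by simp
  also have "\<dots> \<le> L2_norm (\<lambda>x. f x - g x) + L2_norm (\<lambda>x. h x - g x)"
    by (intro L2_norm_triangle L2_diff assms)
  also have "L2_norm (\<lambda>x. h x - g x) = L2_norm (\<lambda>x. g x - h x)"
    by (rule L2_norm_minus_commute)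
  finally show ?thesis .
qed

text \<open>
  A Gaussian profile constrains only the modulus of a state; the unknown phase is removed here at no
  cost.
\<close>

lemma L2_dist_modulus_le:
  assumes f: "f \<in> L2" and g: "g \<in> L2"
  shows "L2_norm (\<lambda>x. of_real (norm (f x)) - of_real (norm (g x))) \<le> L2_norm (\<lambda>x. f x - g x)"
proof (rule L2_norm_mono)
  note [measurable] = L2_measurable[OF f] L2_measurable[OF g]
  show "(\<lambda>x. complex_of_real (norm (f x)) - complex_of_real (norm (g x))) \<in> borel_measurable lborel"
    by measurable
  show "cmod (complex_of_real (norm (f x)) - complex_of_real (norm (g x))) \<le> cmod (f x - g x)" for x
    unfolding of_real_diff[symmetric] norm_of_real by (rule norm_triangle_ineq3)
qed (rule L2_diff[OF f g])

lemma L2_bounded_support: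
  fixes f :: "real^'n::finite \<Rightarrow> complex"
  assumes "f \<in> borel_measurable lborel" "\<And>x. norm (f x) \<le> B" "\<And>x. R < norm x \<Longrightarrow> f x = 0"
  shows "f \<in> L2"
proof (rule L2I)
  show "integrable lborel (\<lambda>x. (norm (f x))\<^sup>2)"
  proof (rule Bochner_Integration.integrable_bound)
    show "integrable lborel (\<lambda>x. B\<^sup>2 * indicator (cball (0::real^'n) R) x :: real)"
      using emeasure_lborel_cball_finite[of "0::real^'n" R]
      by (intro integrable_mult_right integrable_real_indicator) auto
    show "AE x in lborel. norm ((norm (f x))\<^sup>2) \<le> norm (B\<^sup>2 * indicator (cball (0::real^'n) R) x :: real)"
      using assms(2,3) by (intro AE_I2) (auto simp: indicator_def power_mono)
    show "(\<lambda>x. (norm (f x))\<^sup>2) \<in> borel_measurable lborel" using assms(1) by measurable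
  qed
qed (fact assms(1))

lemma integrable_translate_iff:
  fixes f :: "'a::euclidean_space \<Rightarrow> 'b::{banach,second_countable_topology}"
  shows "f \<in> borel_measurable borel \<Longrightarrow>
    integrable lborel (\<lambda>x. f (x - c)) \<longleftrightarrow> integrable lborel f"
  using integrable_distr_eq[of "(+) (-c)" lborel borel f] lborel_distr_plus[of "-c"] by simp

lemma integral_translate:
  fixes f :: "'a::euclidean_space \<Rightarrow> 'b::{banach,second_countable_topology}"
  shows "f \<in> borel_measurable borel \<Longrightarrow>
    (LINT x|lborel. f (x - c)) = (LINT x|lborel. f x)"
  using integral_distr[of "(+) (-c)" lborel borel f] lborel_distr_plus[of "-c"] by simp

lemma L2_translate: "f \<in> L2 \<Longrightarrow> (\<lambda>x. f (x - c)) \<in> L2"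
  by (auto simp: L2_def integrable_translate_iff[of "\<lambda>x. (cmod (f x))\<^sup>2"])

lemma L2_norm_translate: "f \<in> borel_measurable lborel \<Longrightarrow> L2_norm (\<lambda>x. f (x - c)) = L2_norm f"
  by (simp add: L2_norm_def integral_translate[of "\<lambda>x. (cmod (f x))\<^sup>2"])

lemma L2_continuous_bounded_support:
  fixes f :: "real^'n::finite \<Rightarrow> complex"
  assumes f: "continuous_on UNIV f" and z: "\<And>x. R < norm x \<Longrightarrow> f x = 0"
  shows "f \<in> L2"
proof -
  have "bounded (f ` cball 0 R)"
    by (intro compact_imp_bounded compact_continuous_image continuous_on_subset[OF f]) auto
  then obtain B where B: "\<And>x. x \<in> cball 0 R \<Longrightarrow> norm (f x) \<le> B" unfolding bounded_iff by blast
  have "norm (f x) \<le> max B 0" for x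
    using B[of x] z[of x] by (cases "norm x \<le> R") auto
  then show ?thesis
    using borel_measurable_continuous_onI[OF f] by (intro L2_bounded_support[OF _ _ z]) auto
qed

lemma L2_inner_tendsto:
  fixes g0 f0 :: "real^'n::finite \<Rightarrow> complex"
  assumes L2: "\<And>s. f s \<in> L2" "\<And>s. g s \<in> L2" "f0 \<in> L2" "g0 \<in> L2"
    and f: "((\<lambda>s. L2_norm (\<lambda>x. f s x - f0 x)) \<longlongrightarrow> 0) F"
    and g: "((\<lambda>s. L2_norm (\<lambda>x. g s x - g0 x)) \<longlongrightarrow> 0) F"
  shows "((\<lambda>s. L2_inner (f s) (g s)) \<longlongrightarrow> L2_inner f0 g0) F"
proof (rule Lim_transform2[OF tendsto_const], rule Lim_null_comparison)
  let ?a = "\<lambda>s. L2_norm (\<lambda>x. f s x - f0 x)"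
  let ?b = "\<lambda>s. L2_norm (\<lambda>x. g s x - g0 x)"
  have "norm (L2_inner f0 g0 - L2_inner (f s) (g s)) \<le> ?a s * (?b s + L2_norm g0) + L2_norm f0 * ?b s" for s
  proof -
    have "L2_norm (g s) = L2_norm (\<lambda>x. (g s x - g0 x) - (0 - g0 x))" by simp
    also have "\<dots> \<le> ?b s + L2_norm (\<lambda>x. 0 - g0 x)"
      using L2_cmult[OF L2(4), of 0] by (intro L2_norm_triangle L2_diff L2) simp
    also have "L2_norm (\<lambda>x. 0 - g0 x) = L2_norm g0" by (simp add: L2_norm_def)
    finally have gs: "L2_norm (g s) \<le> ?b s + L2_norm g0" .
    have "L2_inner (f s) (g s) - L2_inner f0 g0
        = L2_inner (\<lambda>x. f s x - f0 x) (g s) + L2_inner f0 (\<lambda>x. g s x - g0 x)"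
      by (simp add: L2_inner_diff_left L2_inner_diff_right L2)
    also have "norm \<dots> \<le> ?a s * L2_norm (g s) + L2_norm f0 * ?b s"
      by (intro norm_triangle_le add_mono L2_inner_Cauchy_Schwarz L2_diff L2)
    also have "\<dots> \<le> ?a s * (?b s + L2_norm g0) + L2_norm f0 * ?b s"
      by (intro add_right_mono mult_left_mono gs L2_norm_nonneg)
    finally show ?thesis by (simp add: norm_minus_commute)
  qed
  then show "\<forall>\<^sub>F s in F. norm (L2_inner f0 g0 - L2_inner (f s) (g s))
      \<le> ?a s * (?b s + L2_norm g0) + L2_norm f0 * ?b s" by simp
  show "((\<lambda>s. ?a s * (?b s + L2_norm g0) + L2_norm f0 * ?b s) \<longlongrightarrow> 0) F"
    using tendsto_add[OF tendsto_mult[OF f tendsto_add[OF g tendsto_const[of "L2_norm g0"]]]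
      tendsto_mult[OF tendsto_const[of "L2_norm f0"] g]] by simp
qed

text \<open>
  The form that fits wave packets: along a convergent sequence of parameters they are bounded by one
  constant and live in one ball.
\<close>

lemma L2_dominated_convergence:
  fixes f :: "nat \<Rightarrow> real^'n::finite \<Rightarrow> complex"
  assumes "\<And>n. f n \<in> borel_measurable lborel"
    and lim: "\<And>x. (\<lambda>n. f n x) \<longlonglongrightarrow> 0"
    and bound: "\<And>n x. norm (f n x) \<le> B" and supp: "\<And>n x. R < norm x \<Longrightarrow> f n x = 0"
  shows "(\<lambda>n. L2_norm (f n)) \<longlonglongrightarrow> 0"
proof -
  have "(\<lambda>n. LINT x|lborel. (norm (f n x))\<^sup>2) \<longlonglongrightarrow> (LINT x|(lborel::(real^'n) measure). 0)"
  proof (rule integral_dominated_convergence)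
    show "integrable lborel (\<lambda>x. B\<^sup>2 * indicator (cball (0::real^'n) R) x :: real)"
      using emeasure_lborel_cball_finite[of "0::real^'n" R]
      by (intro integrable_mult_right integrable_real_indicator) auto
    show "AE x in lborel. norm ((norm (f n x))\<^sup>2) \<le> B\<^sup>2 * indicator (cball (0::real^'n) R) x" for n
      using bound supp by (intro AE_I2) (auto simp: indicator_def power_mono)
    show "AE x in lborel. (\<lambda>n. (norm (f n x))\<^sup>2) \<longlonglongrightarrow> 0"
      by (intro AE_I2) (auto intro!: tendsto_eq_intros lim)
  qed (use assms(1) in auto)
  then have "(\<lambda>n. sqrt (LINT x|lborel. (norm (f n x))\<^sup>2)) \<longlonglongrightarrow> sqrt 0"
    by (intro tendsto_real_sqrt) simp
  then show ?thesis by (simp add: L2_norm_def)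
qed

section \<open>Smooth functions\<close>

text \<open>
  The recursion differentiates first and asks for smoothness of the result, so that an induction on
  \<open>n\<close> sees the product and chain rules once per step. The iterated derivatives in \<open>partials\<close> are built
  in the opposite order, with the outermost direction at the head of the list.
\<close>

primrec n_smooth :: "nat \<Rightarrow> (real^'n::finite \<Rightarrow> 'b::real_normed_vector) \<Rightarrow> bool" where
  "n_smooth 0 f = True"
| "n_smooth (Suc n) f =
     ((\<forall>x. f differentiable (at x)) \<and> (\<forall>i. n_smooth n (partials [i] f)))"

lemma partials_append: "partials (\<alpha> @ \<beta>) f = partials \<alpha> (partials \<beta> f)"
  by (induction \<alpha>) simp_all

text \<open>
  Splitting a list of directions at its last entry moves the innermost derivative to the front, which
  reconciles the two recursions.
\<close>

lemma n_smooth_iff: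
  "n_smooth n f \<longleftrightarrow> (\<forall>\<alpha> x. length \<alpha> < n \<longrightarrow> partials \<alpha> f differentiable (at x))"
proof (induction n arbitrary: f)
  case (Suc n)
  show ?case
  proof
    assume L: "n_smooth (Suc n) f"
    show "\<forall>\<alpha> x. length \<alpha> < Suc n \<longrightarrow> partials \<alpha> f differentiable (at x)"
    proof (intro allI impI)
      fix \<alpha> :: "'a list" and x assume len: "length \<alpha> < Suc n"
      show "partials \<alpha> f differentiable (at x)"
      proof (cases \<alpha> rule: rev_cases)
        case Nil then show ?thesis using L by simp
      next
        case (snoc \<beta> i)
        then show ?thesis using L len Suc.IH[of "partials [i] f"] by (simp add: partials_append)
      qed
    qed
  next
    assume R: "\<forall>\<alpha> x. length \<alpha> < Suc n \<longrightarrow> partials \<alpha> f differentiable (at x)"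
    have "n_smooth n (partials [i] f)" for i
      unfolding Suc.IH using R by (auto simp: partials_append[symmetric] simp del: partials.simps)
    then show "n_smooth (Suc n) f" using R[rule_format, of "[]"] by auto
  qed
qed simp

lemma smooth_iff_n_smooth: "smooth f \<longleftrightarrow> (\<forall>n. n_smooth n f)"
  unfolding smooth_def n_smooth_iff by blast

lemma n_smooth_SucD: "n_smooth (Suc n) f \<Longrightarrow> n_smooth n f"
  unfolding n_smooth_iff by auto

lemma smooth_differentiable: "smooth f \<Longrightarrow> f differentiable (at x)"
  unfolding smooth_def by (metis partials.simps(1))

lemma smooth_partials: "smooth f \<Longrightarrow> smooth (partials \<alpha> f)"
  unfolding smooth_def by (metis partials_append)

lemma smooth_continuous_on: "smooth f \<Longrightarrow> continuous_on A f"
  by (meson smooth_differentiable differentiable_imp_continuous_within continuous_at_imp_continuous_on)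

lemma partial_eqI:
  assumes "\<And>x. (f has_derivative f' x) (at x)"
  shows "partials [i] f = (\<lambda>x. f' x (axis i 1))"
  using frechet_derivative_at[OF assms] by auto

lemma n_smooth_SucI:
  assumes "\<And>x. (f has_derivative f' x) (at x)" "\<And>i. n_smooth n (\<lambda>x. f' x (axis i 1))"
  shows "n_smooth (Suc n) f"
  using assms unfolding n_smooth.simps partial_eqI[OF assms(1)] differentiable_def by blast

lemma n_smooth_SucE:
  assumes "n_smooth (Suc n) f"
  obtains f' where "\<And>x. (f has_derivative f' x) (at x)" "\<And>i. n_smooth n (\<lambda>x. f' x (axis i 1))"
proof
  show d: "(f has_derivative frechet_derivative f (at x)) (at x)" for x
    using assms by (simp add: frechet_derivative_works)
  show "n_smooth n (\<lambda>x. frechet_derivative f (at x) (axis i 1))" for i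
    using assms by simp
qed

lemma n_smooth_const: "n_smooth n (\<lambda>x. c)"
proof (induction n arbitrary: c)
  case (Suc n)
  show ?case by (rule n_smooth_SucI[where f'="\<lambda>x h. 0"]) (use Suc in auto)
qed simp

lemma n_smooth_bounded_linear: "bounded_linear f \<Longrightarrow> n_smooth n f"
  by (cases n)
    (auto intro!: n_smooth_SucI[where f'="\<lambda>x. f"] n_smooth_const bounded_linear_imp_has_derivative
      simp del: n_smooth.simps(2))

lemma n_smooth_add: "n_smooth n f \<Longrightarrow> n_smooth n g \<Longrightarrow> n_smooth n (\<lambda>x. f x + g x)"
proof (induction n arbitrary: f g)
  case (Suc n)
  from n_smooth_SucE[OF Suc.prems(1)] obtain f' where f: "\<And>x. (f has_derivative f' x) (at x)"
    "\<And>i. n_smooth n (\<lambda>x. f' x (axis i 1))" by blast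
  from n_smooth_SucE[OF Suc.prems(2)] obtain g' where g: "\<And>x. (g has_derivative g' x) (at x)"
    "\<And>i. n_smooth n (\<lambda>x. g' x (axis i 1))" by blast
  show ?case
    by (rule n_smooth_SucI[where f'="\<lambda>x h. f' x h + g' x h"])
      (auto intro: has_derivative_add f g Suc.IH)
qed simp

lemma n_smooth_mult:
  fixes f g :: "real^'n::finite \<Rightarrow> 'b::real_normed_algebra"
  shows "n_smooth n f \<Longrightarrow> n_smooth n g \<Longrightarrow> n_smooth n (\<lambda>x. f x * g x)"
proof (induction n arbitrary: f g)
  case (Suc n)
  from n_smooth_SucE[OF Suc.prems(1)] obtain f' where f: "\<And>x. (f has_derivative f' x) (at x)"
    "\<And>i. n_smooth n (\<lambda>x. f' x (axis i 1))" by blast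
  from n_smooth_SucE[OF Suc.prems(2)] obtain g' where g: "\<And>x. (g has_derivative g' x) (at x)"
    "\<And>i. n_smooth n (\<lambda>x. g' x (axis i 1))" by blast
  show ?case
    by (rule n_smooth_SucI[where f'="\<lambda>x h. f x * g' x h + f' x h * g x"])
      (auto intro!: has_derivative_mult f g n_smooth_add Suc.IH n_smooth_SucD[OF Suc.prems(1)]
        n_smooth_SucD[OF Suc.prems(2)])
qed simp

lemma n_smooth_linear_image:
  assumes "bounded_linear L"
  shows "n_smooth n f \<Longrightarrow> n_smooth n (\<lambda>x. L (f x))"
proof (induction n arbitrary: f)
  case (Suc n)
  from n_smooth_SucE[OF Suc.prems(1)] obtain f' where f: "\<And>x. (f has_derivative f' x) (at x)"
    "\<And>i. n_smooth n (\<lambda>x. f' x (axis i 1))" by blast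
  show ?case
    by (rule n_smooth_SucI[where f'="\<lambda>x h. L (f' x h)"])
      (auto intro!: bounded_linear.has_derivative[OF assms] f Suc.IH)
qed simp

lemma n_smooth_exp:
  fixes f :: "real^'n::finite \<Rightarrow> 'b::{real_normed_field,banach}"
  shows "n_smooth n f \<Longrightarrow> n_smooth n (\<lambda>x. exp (f x))"
proof (induction n)
  case (Suc n)
  from n_smooth_SucE[OF Suc.prems(1)] obtain f' where f: "\<And>x. (f has_derivative f' x) (at x)"
    "\<And>i. n_smooth n (\<lambda>x. f' x (axis i 1))" by blast
  have "((\<lambda>x. exp (f x)) has_derivative (\<lambda>h. exp (f x) * f' x h)) (at x)" for x
    using has_derivative_compose[OF f(1) DERIV_exp[unfolded has_field_derivative_def], of x]
    by simp
  then show ?case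
    by (rule n_smooth_SucI) (auto intro!: n_smooth_mult f Suc.IH n_smooth_SucD[OF Suc.prems])
qed simp

lemma n_smooth_translate: "n_smooth n f \<Longrightarrow> n_smooth n (\<lambda>x. f (x - c))"
proof (induction n arbitrary: f)
  case (Suc n)
  from n_smooth_SucE[OF Suc.prems(1)] obtain f' where f: "\<And>x. (f has_derivative f' x) (at x)"
    "\<And>i. n_smooth n (\<lambda>x. f' x (axis i 1))" by blast
  have "((\<lambda>x. x - c) has_derivative (\<lambda>h. h)) (at x)" for x
    by (auto intro!: derivative_eq_intros)
  from has_derivative_compose[OF this f(1)]
  have "((\<lambda>x. f (x - c)) has_derivative f' (x - c)) (at x)" for x .
  then show ?case
    by (rule n_smooth_SucI[where f'="\<lambda>x. f' (x - c)"]) (rule Suc.IH[OF f(2)])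
qed simp

lemma n_smooth_sum:
  "(\<And>i. i \<in> I \<Longrightarrow> n_smooth n (f i)) \<Longrightarrow> n_smooth n (\<lambda>x. \<Sum>i\<in>I. f i x)"
  by (induction I rule: infinite_finite_induct) (auto intro: n_smooth_const n_smooth_add)

lemma n_smooth_norm_power2: "n_smooth n (\<lambda>x::real^'n::finite. (norm x)\<^sup>2)"
  unfolding power2_norm_eq_inner inner_vec_def inner_real_def
  by (intro n_smooth_sum n_smooth_mult n_smooth_bounded_linear bounded_linear_vec_nth)

text \<open>
  Up to the factor \<open>s\<^sup>-\<^sup>k\<close> this is the standard function \<open>exp (-1/s)\<close> that vanishes to infinite order at
  \<open>0\<close>. The whole family is considered because it is closed under differentiation modulo linear
  combinations, which makes smoothness an induction over all \<open>k\<close> simultaneously.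
\<close>

definition flat :: "nat \<Rightarrow> real \<Rightarrow> real" where
  "flat k s = (if s \<le> 0 then 0 else (1 / s) ^ k * exp (- (1 / s)))"

text \<open>
  The estimate \<open>(1 + x/k)\<^sup>k \<le> exp x\<close> at \<open>x = 1/s\<close>.
\<close>

lemma flat_bounded: "\<bar>flat k s\<bar> \<le> real k ^ k"
proof (cases "s \<le> 0 \<or> k = 0")
  case False
  then have s: "1 / s > 0" "k > 0" "s > 0" by auto
  have "(1 / s / k) ^ k \<le> (1 + 1 / s / k) ^ k" using s by (intro power_mono) auto
  also have "\<dots> \<le> exp (1 / s)"
    using s by (intro exp_ge_one_plus_x_over_n_power_n) (auto intro: order_trans[of _ 0])
  finally have "(1 / s) ^ k \<le> real k ^ k * exp (1 / s)"
    using s by (simp add: power_divide field_simps)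
  then show ?thesis using s by (simp add: flat_def exp_minus field_simps abs_mult)
qed (auto simp: flat_def)

text \<open>
  Only \<open>s = 0\<close> needs an argument: there the difference quotient is \<open>h\<close> times a bounded function of the
  same family.
\<close>

lemma flat_has_derivative:
  "(flat k has_real_derivative (flat (k + 2) s - real k * flat (k + 1) s)) (at s)"
proof (cases s "0::real" rule: linorder_cases)
  case less
  have "((\<lambda>_. 0) has_real_derivative 0) (at s)" by simp
  then have "(flat k has_real_derivative 0) (at s)"
    by (rule has_field_derivative_transform_within_open[where S="{..<0}"])
      (use less in \<open>auto simp: flat_def\<close>)
  then show ?thesis using less by (simp add: flat_def)
next
  case greater
  have "((\<lambda>s. (1 / s) ^ k * exp (- (1 / s))) has_real_derivative
      (flat (k + 2) s - real k * flat (k + 1) s)) (at s)"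
  proof -
    define r where "r = 1 / s"
    have r: "((\<lambda>s. 1 / s) has_real_derivative - (r\<^sup>2)) (at s)"
      using greater by (auto intro!: derivative_eq_intros simp: r_def field_simps power2_eq_square)
    show ?thesis
      using greater DERIV_mult[OF DERIV_power[OF r, of k] DERIV_fun_exp[OF DERIV_minus[OF r]]]
      by (cases k) (simp_all add: flat_def r_def[symmetric] algebra_simps power2_eq_square)
  qed
  then show ?thesis
    by (rule has_field_derivative_transform_within_open[where S="{0<..}"])
      (use greater in \<open>auto simp: flat_def\<close>)
next
  case equal
  have "((\<lambda>h. flat k h / h) \<longlongrightarrow> 0) (at 0)"
  proof (rule Lim_null_comparison)
    show "((\<lambda>h::real. \<bar>h\<bar> * real (k + 2) ^ (k + 2)) \<longlongrightarrow> 0) (at 0)"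
      by (auto intro!: tendsto_eq_intros)
    have "norm (flat k h / h) \<le> \<bar>h\<bar> * real (k + 2) ^ (k + 2)" for h
    proof -
      have "flat k h / h = h * flat (k + 2) h"
        by (auto simp: flat_def field_simps power2_eq_square)
      then show ?thesis using flat_bounded[of "k + 2" h]
        by (simp add: abs_mult mult_left_mono del: of_nat_add)
    qed
    then show "\<forall>\<^sub>F h in at 0. norm (flat k h / h) \<le> \<bar>h\<bar> * real (k + 2) ^ (k + 2)" by simp
  qed
  then show ?thesis using equal by (simp add: DERIV_def flat_def)
qed

lemma n_smooth_flat:
  fixes u :: "real^'n::finite \<Rightarrow> real"
  shows "n_smooth n u \<Longrightarrow> n_smooth n (\<lambda>x. flat k (u x))"
proof (induction n arbitrary: k)
  case (Suc n)
  from n_smooth_SucE[OF Suc.prems(1)] obtain u' where u: "\<And>x. (u has_derivative u' x) (at x)"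
    "\<And>i. n_smooth n (\<lambda>x. u' x (axis i 1))" by blast
  have "((\<lambda>x. flat k (u x)) has_derivative
      (\<lambda>h. (flat (k + 2) (u x) + (- real k) * flat (k + 1) (u x)) * u' x h)) (at x)" for x
    using DERIV_compose_FDERIV[OF flat_has_derivative u(1), of k x] by (simp add: mult.commute)
  then show ?case
    by (rule n_smooth_SucI)
      (intro n_smooth_mult n_smooth_add n_smooth_const u Suc.IH n_smooth_SucD[OF Suc.prems])
qed simp

lemma has_derivative_sum_partials:
  fixes f :: "real^'n::finite \<Rightarrow> 'b::real_normed_vector"
  assumes "f differentiable (at x)"
  shows "(f has_derivative (\<lambda>h. \<Sum>i\<in>UNIV. (h $ i) *\<^sub>R partials [i] f x)) (at x)"
proof -
  have d: "(f has_derivative frechet_derivative f (at x)) (at x)"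
    using assms by (simp add: frechet_derivative_works)
  then have l: "linear (frechet_derivative f (at x))" by (rule has_derivative_linear)
  have "frechet_derivative f (at x) h = (\<Sum>i\<in>UNIV. (h $ i) *\<^sub>R partials [i] f x)" for h :: "real^'n"
  proof -
    have "frechet_derivative f (at x) h = frechet_derivative f (at x) (\<Sum>i\<in>UNIV. h $ i *\<^sub>R axis i 1)"
      using basis_expansion[of h] by (simp add: scalar_mult_eq_scaleR)
    also have "\<dots> = (\<Sum>i\<in>UNIV. (h $ i) *\<^sub>R partials [i] f x)"
      by (simp add: linear_sum[OF l] linear_scale[OF l])
    finally show ?thesis .
  qed
  then show ?thesis using d by presburger
qed

section \<open>Gaussians and their translates\<close>

text \<open>
  The modulus of the initial state, centred at the origin.
\<close>

definition gauss :: "real \<Rightarrow> real^'n::finite \<Rightarrow> real" where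
  "gauss b y = b powr (real CARD('n) / 4) / gauss_const TYPE('n) * exp (- (b / 2) * (norm y)\<^sup>2)"

lemma gauss_measurable [measurable]: "gauss b \<in> borel_measurable borel"
  unfolding gauss_def[abs_def] by measurable

text \<open>
  The integral factors over the coordinates into one-dimensional Gaussian integrals.
\<close>

lemma integrable_exp_minus_norm_power2:
  "integrable lborel (\<lambda>y::real^'n::finite. exp (- (norm y)\<^sup>2))"
proof -
  have "has_bochner_integral lborel (\<lambda>x::real. exp (- x\<^sup>2)) (2 *\<^sub>R (sqrt pi / 2))"
    by (rule has_bochner_integral_even_function[OF gaussian_moment_0]) simp
  then have "(\<integral>\<^sup>+x. ennreal (exp (- x\<^sup>2)) \<partial>(lborel :: real measure)) < \<infinity>"
    by (subst nn_integral_eq_integral) (auto simp: has_bochner_integral_iff)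
  then have fin: "(\<Prod>b\<in>(Basis :: (real^'n) set). \<integral>\<^sup>+x. ennreal (exp (- x\<^sup>2)) \<partial>(lborel :: real measure)) < \<infinity>"
    by (simp add: power_less_top_ennreal)
  have "(norm y)\<^sup>2 = (\<Sum>b\<in>Basis. (y \<bullet> b)\<^sup>2)" for y :: "real^'n"
    unfolding power2_norm_eq_inner by (subst euclidean_inner) (simp add: power2_eq_square)
  then have "ennreal (exp (- (norm y)\<^sup>2)) = (\<Prod>b\<in>Basis. ennreal (exp (- (y \<bullet> b)\<^sup>2)))" for y :: "real^'n"
    by (simp add: prod_ennreal sum_negf[symmetric] exp_sum)
  then have "(\<integral>\<^sup>+y. ennreal (exp (- (norm y)\<^sup>2)) \<partial>(lborel :: (real^'n) measure)) < \<infinity>"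
    using fin nn_integral_lborel_prod[of "\<lambda>(_::real^'n) x. ennreal (exp (- x\<^sup>2))"] by simp
  then show ?thesis by (intro integrableI_bounded) auto
qed

lemma gauss_const_pos: "gauss_const TYPE('n::finite) > 0"
proof -
  have "(LINT y::real^'n|lborel. exp (- (norm y)\<^sup>2)) \<noteq> 0"
  proof
    assume "(LINT y::real^'n|lborel. exp (- (norm y)\<^sup>2)) = 0"
    moreover have "AE y::real^'n in lborel. 0 \<le> exp (- (norm y)\<^sup>2)" by simp
    ultimately have "AE y::real^'n in lborel. exp (- (norm y)\<^sup>2) = 0"
      using iffD1[OF integral_nonneg_eq_0_iff_AE[OF integrable_exp_minus_norm_power2]] by blast
    then have "AE y::real^'n in lborel. False" by eventually_elim simp
    then show False by (simp add: ae_filter_eq_bot_iff eventually_False)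
  qed
  moreover have "(LINT y::real^'n|lborel. exp (- (norm y)\<^sup>2)) \<ge> 0" by simp
  ultimately show ?thesis by (simp add: gauss_const_def less_le)
qed

lemma gauss_nonneg: "0 \<le> gauss b (y :: real^'n::finite)"
  using gauss_const_pos[where 'n='n] by (simp add: gauss_def)

text \<open>
  The substitution \<open>y = \<surd>b x\<close> reduces both claims to the integral that defines the normalising
  constant.
\<close>

lemma gauss_normalized:
  assumes "b > 0"
  shows "integrable lborel (\<lambda>y::real^'n::finite. (gauss b y)\<^sup>2)"
    and "(LINT y::real^'n|lborel. (gauss b y)\<^sup>2) = 1"
proof -
  define c where "c = sqrt b"
  have c: "c > 0" "c\<^sup>2 = b" using assms by (auto simp: c_def)
  define f where "f = (\<lambda>y::real^'n. exp (- (norm y)\<^sup>2))"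
  have [measurable]: "f \<in> borel_measurable borel" unfolding f_def by measurable
  have lb: "(lborel :: (real^'n) measure) = density (distr lborel borel (\<lambda>x. 0 + c *\<^sub>R x)) (\<lambda>_. ennreal (\<bar>c\<bar> ^ CARD('n)))"
    using lborel_affine[of c "0::real^'n"] c by simp
  have fi: "integrable lborel f" unfolding f_def by (rule integrable_exp_minus_norm_power2)
  have 1: "integrable lborel (\<lambda>x. c ^ CARD('n) * f (c *\<^sub>R x))"
    using fi by (subst (asm) lb) (use c in \<open>simp add: integrable_density integrable_distr_eq\<close>)
  have 2: "(LINT x|lborel. f x) = (LINT x|lborel. c ^ CARD('n) * f (c *\<^sub>R x))"
    by (subst lb) (use c in \<open>simp add: integral_density integral_distr\<close>)
  have C: "(gauss_const TYPE('n))\<^sup>2 = (LINT x|lborel. f x)"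
    unfolding gauss_const_def f_def by simp
  have p: "(b powr (real CARD('n) / 4))\<^sup>2 = c ^ CARD('n)"
  proof -
    have "(b powr (real CARD('n) / 4))\<^sup>2 = b powr (real CARD('n) / 2)"
      by (simp add: power2_eq_square powr_add[symmetric])
    also have "\<dots> = c powr real CARD('n)"
      using assms by (simp add: c_def powr_half_sqrt[symmetric] powr_powr)
    finally show ?thesis using c by (simp add: powr_realpow)
  qed
  have "(gauss b y)\<^sup>2 = c ^ CARD('n) * f (c *\<^sub>R y) / (gauss_const TYPE('n))\<^sup>2" for y :: "real^'n"
  proof -
    have "(exp (- (b / 2) * (norm y)\<^sup>2))\<^sup>2 = f (c *\<^sub>R y)"
      using c by (simp add: f_def exp_double[symmetric] power_mult_distrib)
    then show ?thesis unfolding gauss_def power_mult_distrib power_divide p by simp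
  qed
  note e = this
  show "integrable lborel (\<lambda>y::real^'n. (gauss b y)\<^sup>2)" unfolding e using 1 by simp
  show "(LINT y::real^'n|lborel. (gauss b y)\<^sup>2) = 1"
    unfolding e integral_divide_zero 2[symmetric] C[symmetric] using gauss_const_pos[where 'n='n] by simp
qed

lemma gauss_L2: "b > 0 \<Longrightarrow> (\<lambda>y. complex_of_real (gauss b (y - \<gamma>))) \<in> L2"
  by (intro L2_translate[where f="\<lambda>y. complex_of_real (gauss b y)"] L2I)
    (auto simp: gauss_normalized(1))

lemma L2_norm_gauss: "b > 0 \<Longrightarrow> L2_norm (\<lambda>y. complex_of_real (gauss b (y - \<gamma>))) = 1"
  by (subst L2_norm_translate[where f="\<lambda>y. complex_of_real (gauss b y)"])
    (auto simp: L2_norm_def gauss_normalized(2))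

lemma gaussian_state_eq:
  "gaussian_state b x0 v0 x = exp (\<i> * of_real (v0 \<bullet> (x - x0))) * of_real (gauss b (x - x0))"
  unfolding gaussian_state_def gauss_def exp_add exp_of_real by (simp only: of_real_mult mult_ac)

lemma gaussian_state_L2:
  assumes "b > 0"
  shows "gaussian_state b x0 v0 \<in> L2" "L2_norm (gaussian_state b x0 v0) = 1"
proof -
  have m: "gaussian_state b x0 v0 \<in> borel_measurable lborel"
    unfolding gaussian_state_eq[abs_def] by measurable
  have n: "norm (gaussian_state b x0 v0 x) = norm (complex_of_real (gauss b (x - x0)))" for x
    by (simp add: gaussian_state_eq norm_mult)
  show "gaussian_state b x0 v0 \<in> L2"
    by (rule L2_dominated[OF gauss_L2[OF assms, of x0] m]) (simp only: n order_refl)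
  show "L2_norm (gaussian_state b x0 v0) = 1"
    using L2_norm_gauss[OF assms, of x0] unfolding L2_norm_def n by simp
qed

text \<open>
  By the parallelogram identity the product of two translates is the square of the translate to the
  midpoint, damped by a constant factor. The distance thus controls \<open>\<parallel>\<gamma> - \<gamma>'\<parallel>\<close> in both directions.
\<close>

lemma gauss_translates_distance:
  fixes \<gamma> \<gamma>' :: "real^'n::finite"
  assumes b: "b > 0"
  shows "(L2_norm (\<lambda>x. of_real (gauss b (x - \<gamma>)) - of_real (gauss b (x - \<gamma>'))))\<^sup>2
    = 2 - 2 * exp (- (b / 4) * (norm (\<gamma> - \<gamma>'))\<^sup>2)"
proof -
  define m where "m = (1/2) *\<^sub>R (\<gamma> + \<gamma>')"
  have "(norm (x - \<gamma>))\<^sup>2 + (norm (x - \<gamma>'))\<^sup>2 = 2 * (norm (x - m))\<^sup>2 + (norm (\<gamma> - \<gamma>'))\<^sup>2 / 2" for x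
    by (simp add: m_def power2_norm_eq_inner inner_simps inner_commute field_simps)
  then have "exp (- (b / 2) * (norm (x - \<gamma>))\<^sup>2) * exp (- (b / 2) * (norm (x - \<gamma>'))\<^sup>2)
      = exp (- (b / 4) * (norm (\<gamma> - \<gamma>'))\<^sup>2) * (exp (- (b / 2) * (norm (x - m))\<^sup>2))\<^sup>2" for x
    unfolding exp_double[symmetric] exp_add[symmetric] distrib_left[symmetric]
    by (simp add: algebra_simps)
  then have p: "gauss b (x - \<gamma>) * gauss b (x - \<gamma>')
      = exp (- (b / 4) * (norm (\<gamma> - \<gamma>'))\<^sup>2) * (gauss b (x - m))\<^sup>2" for x
    unfolding gauss_def power_mult_distrib
    by (simp add: power2_eq_square mult_ac)
  have "L2_inner (\<lambda>x. of_real (gauss b (x - \<gamma>))) (\<lambda>x. of_real (gauss b (x - \<gamma>')))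
      = complex_of_real (LINT x|lborel. gauss b (x - \<gamma>) * gauss b (x - \<gamma>'))"
    by (simp add: L2_inner_def of_real_mult[symmetric] del: of_real_mult)
  also have "\<dots> = of_real (exp (- (b / 4) * (norm (\<gamma> - \<gamma>'))\<^sup>2))"
    unfolding p using integral_translate[of "\<lambda>x::real^'n. (gauss b x)\<^sup>2" m] gauss_normalized(2)[OF b, where 'n='n]
    by simp
  finally show ?thesis
    unfolding L2_norm_diff_power2[OF gauss_L2[OF b] gauss_L2[OF b]] by (simp add: L2_norm_gauss[OF b])
qed

lemma mat_mult_vec: "mat c *v (x :: real^'n::finite) = c *\<^sub>R x"
  by (simp add: matrix_scaleR[symmetric] matrix_works)

text \<open>
  For \<open>b > 0\<close>: if \<open>R\<close> is positive semidefinite with \<open>R\<^sup>2 = b\<close>, then \<open>w = Rv - \<surd>b v\<close> satisfies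
  \<open>Rw + \<surd>b w = 0\<close>, and pairing with \<open>w\<close> forces \<open>w = 0\<close>.
\<close>

lemma matrix_sqrt_mat:
  assumes "b \<ge> 0"
  shows "matrix_sqrt (mat b :: real^'n::finite^'n) = mat (sqrt b)"
  unfolding matrix_sqrt_def
proof (rule the_equality)
  have "(mat (sqrt b) ** mat (sqrt b) :: real^'n^'n) = mat b"
    using assms by (simp add: matrix_eq matrix_vector_mul_assoc[symmetric] mat_mult_vec)
  then show "sym_pos_semidef (mat (sqrt b) :: real^'n^'n) \<and> (mat (sqrt b) ** mat (sqrt b) :: real^'n^'n) = mat b"
    using assms by (simp add: sym_pos_semidef_def mat_mult_vec transpose_mat)
next
  fix R :: "real^'n^'n" assume R: "sym_pos_semidef R \<and> R ** R = mat b"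
  have "R *v v = sqrt b *\<^sub>R v" for v
  proof (cases "b = 0")
    case True
    then have "(R *v v) \<bullet> (R *v v) = v \<bullet> (R *v (R *v v))"
      using R dot_lmul_matrix[of v R "R *v v"] 
      by (simp add: sym_pos_semidef_def) (metis transpose_matrix_vector)
    also have "\<dots> = 0" using R True by (simp add: matrix_vector_mul_assoc mat_mult_vec)
    finally show ?thesis using True by simp
  next
    case False
    define w where "w = R *v v - sqrt b *\<^sub>R v"
    have "R *v w + sqrt b *\<^sub>R w = (R ** R) *v v - b *\<^sub>R v"
      using assms by (simp add: w_def matrix_vector_mult_diff_distrib matrix_vector_mult_scaleR
          matrix_vector_mul_assoc[symmetric] algebra_simps)
    then have "R *v w + sqrt b *\<^sub>R w = 0" using R by (simp add: mat_mult_vec)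
    then have "w \<bullet> (R *v w) + sqrt b * (w \<bullet> w) = 0"
      by (metis inner_add_right inner_scaleR_right inner_zero_right)
    moreover have "w \<bullet> (R *v w) \<ge> 0" using R by (simp add: sym_pos_semidef_def)
    moreover have "sqrt b * (w \<bullet> w) \<ge> 0" using assms by simp
    ultimately have "sqrt b * (w \<bullet> w) = 0" by linarith
    then have "w = 0" using False by simp
    then show ?thesis by (simp add: w_def)
  qed
  then show "R = mat (sqrt b)" by (simp add: matrix_eq mat_mult_vec)
qed

lemma gaussian_profile_mat:
  assumes "b > 0"
  shows "gaussian_profile (mat b) \<gamma> (x :: real^'n::finite) = gauss b (x - \<gamma>)"
proof -
  have "det (mat b :: real^'n^'n) = b ^ CARD('n)"
    by (simp add: matrix_scaleR[symmetric])
  then have "det (mat b :: real^'n^'n) powr (1 / 4) = b powr (real CARD('n) / 4)"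
    using assms by (simp add: powr_realpow[symmetric] powr_powr)
  then show ?thesis
    using assms by (simp add: gaussian_profile_def gauss_def matrix_sqrt_mat mat_mult_vec power_mult_distrib)
qed

text \<open>
  If the distance were not bounded below, some translates would converge to \<open>\<bar>\<psi>\<bar>\<close>. They then form a
  Cauchy sequence in \<open>L\<^sup>2\<close>, so by the explicit distance between translates their centres form a
  Cauchy sequence in \<open>\<real>\<^sup>N\<close>. Hence the centres cannot escape to infinity, and at their limit \<open>\<bar>\<psi>\<bar>\<close> is a
  Gaussian profile with matrix \<open>b I\<close>.
\<close>

lemma positive_distance_to_gauss_translates:
  fixes \<psi> :: "real^'n::finite \<Rightarrow> complex"
  assumes b: "b > 0" and psi: "\<psi> \<in> L2" and nprof: "\<not> has_gaussian_profile \<psi>"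
  shows "\<exists>d>0. \<forall>\<gamma>. d \<le> L2_norm (\<lambda>x. of_real (gauss b (x - \<gamma>)) - of_real (norm (\<psi> x)))"
proof (rule ccontr)
  let ?D = "\<lambda>\<gamma>. L2_norm (\<lambda>x. of_real (gauss b (x - \<gamma>)) - of_real (norm (\<psi> x)))"
  let ?G = "\<lambda>\<gamma> \<gamma>'. L2_norm (\<lambda>x. of_real (gauss b (x - \<gamma>)) - of_real (gauss b (x - \<gamma>')))"
  note [measurable] = L2_measurable[OF psi]
  have abs_psi: "(\<lambda>x. complex_of_real (norm (\<psi> x))) \<in> L2"
    by (rule L2_dominated[OF psi]) auto
  assume "\<not> ?thesis"
  then have "\<exists>\<gamma>. ?D \<gamma> < 1 / real (Suc n)" for n
    by (metis not_le zero_less_divide_1_iff of_nat_0_less_iff zero_less_Suc)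
  then obtain \<gamma> where \<gamma>: "?D (\<gamma> n) < 1 / real (Suc n)" for n by metis
  have G: "?G (\<gamma> n) (\<gamma> m) < 1 / real (Suc n) + 1 / real (Suc m)" for n m
    using L2_dist_triangle[OF gauss_L2[OF b, of "\<gamma> n"] abs_psi gauss_L2[OF b, of "\<gamma> m"]] \<gamma>[of n] \<gamma>[of m]
    by (subst (asm) (3) L2_norm_minus_commute) linarith
  have "Cauchy \<gamma>"
  proof (rule CauchyI)
    fix e :: real assume e: "e > 0"
    \<comment> \<open>The distance between translates whose centres are exactly \<open>e\<close> apart.\<close>
    define c where "c = sqrt (2 - 2 * exp (- (b / 4) * e\<^sup>2))"
    have c: "c > 0" using b e by (simp add: c_def)
    obtain N where N: "1 / real (Suc N) < c / 2" using c by (meson half_gt_zero nat_approx_posE)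
    have "norm (\<gamma> m - \<gamma> n) < e" if "m \<ge> N" "n \<ge> N" for m n
    proof -
      have "1 / real (Suc m) \<le> 1 / real (Suc N)" "1 / real (Suc n) \<le> 1 / real (Suc N)"
        using that by (auto simp: divide_simps)
      then have "?G (\<gamma> m) (\<gamma> n) < c" using G[of m n] N by linarith
      then have "(?G (\<gamma> m) (\<gamma> n))\<^sup>2 < c\<^sup>2" by (intro power_strict_mono) (auto simp: L2_norm_nonneg)
      also have "c\<^sup>2 = 2 - 2 * exp (- (b / 4) * e\<^sup>2)"
        unfolding c_def using b by (intro real_sqrt_pow2) auto
      finally have "(norm (\<gamma> m - \<gamma> n))\<^sup>2 < e\<^sup>2"
        using b unfolding gauss_translates_distance[OF b] by simp
      then show ?thesis using e by (simp add: power_less_imp_less_base)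
    qed
    then show "\<exists>N. \<forall>m\<ge>N. \<forall>n\<ge>N. norm (\<gamma> m - \<gamma> n) < e" by blast
  qed
  then obtain \<gamma>0 where lim: "\<gamma> \<longlonglongrightarrow> \<gamma>0" using Cauchy_convergent_iff convergent_def by blast
  have "(\<lambda>n. ?G \<gamma>0 (\<gamma> n)) \<longlonglongrightarrow> 0"
  proof -
    have "?G \<gamma>0 \<gamma>' = sqrt (2 - 2 * exp (- (b / 4) * (norm (\<gamma>0 - \<gamma>'))\<^sup>2))" for \<gamma>'
      by (rule real_sqrt_unique[symmetric]) (auto simp: gauss_translates_distance[OF b] L2_norm_nonneg)
    then show ?thesis
      by (simp only:) (auto intro!: tendsto_eq_intros lim)
  qed
  moreover have "(\<lambda>n. 1 / real (Suc n)) \<longlonglongrightarrow> 0" using LIMSEQ_inverse_real_of_nat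
    by (simp add: inverse_eq_divide)
  ultimately have "(\<lambda>n. ?G \<gamma>0 (\<gamma> n) + 1 / real (Suc n)) \<longlonglongrightarrow> 0"
    using tendsto_add by fastforce
  moreover have "?D \<gamma>0 \<le> ?G \<gamma>0 (\<gamma> n) + 1 / real (Suc n)" for n
    using L2_dist_triangle[OF gauss_L2[OF b, of \<gamma>0] gauss_L2[OF b, of "\<gamma> n"] abs_psi] \<gamma>[of n] by linarith
  ultimately have "?D \<gamma>0 \<le> 0" by (meson LIMSEQ_le_const)
  then have "?D \<gamma>0 = 0" by (meson L2_norm_nonneg order_antisym)
  then have "AE x in lborel. complex_of_real (gauss b (x - \<gamma>0)) - of_real (norm (\<psi> x)) = 0"
    by (intro L2_norm_eq_0_AE L2_diff gauss_L2 b abs_psi)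
  then have "AE x in lborel. norm (\<psi> x) = gaussian_profile (mat b) \<gamma>0 x"
    unfolding gaussian_profile_mat[OF b] by eventually_elim (simp add: of_real_diff[symmetric] del: of_real_diff)
  moreover have "sym_pos_def (mat b :: real^'n^'n)"
    using b by (simp add: sym_pos_def_def mat_mult_vec transpose_mat)
  ultimately show False using nprof unfolding has_gaussian_profile_def by blast
qed

text \<open>
  The equation of motion may only be tested against smooth functions of compact support, so the
  Gaussian is multiplied by a bump function on a large ball. The bump function is
  \<open>exp (1 - 1/(1 - \<parallel>y\<parallel>\<^sup>2/n\<^sup>2))\<close>; it has no plateau, but it increases to \<open>1\<close> pointwise and stays in
  \<open>[0, 1]\<close>, which is enough for dominated convergence.
\<close>

lemma smooth_compact_support_approximation_of_gauss:
  assumes b: "b > 0" and e: "e > 0"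
  shows "\<exists>(g :: real^'n::finite \<Rightarrow> real) R. smooth g \<and> (\<forall>y. R \<le> norm y \<longrightarrow> g y = 0) \<and>
    L2_norm (\<lambda>y. of_real (g y) - of_real (gauss b y)) < e"
proof -
  define bump where "bump n y = exp 1 * flat 0 (1 - (norm y)\<^sup>2 / (real (Suc n))\<^sup>2)" for n and y :: "real^'n"
  define g where "g n y = gauss b y * bump n y" for n and y :: "real^'n"
  have chi01: "0 \<le> bump n y \<and> bump n y \<le> 1" for n y
  proof -
    have "1 \<le> 1 / s" if "0 < s" "s \<le> 1" for s :: real using that by simp
    then have "exp 1 * flat 0 s \<in> {0..1}" if "s \<le> 1" for s :: real
      using that by (auto simp: flat_def exp_add[symmetric])
    then show ?thesis by (simp add: bump_def)
  qed
  have smooth: "smooth (g n)" for n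
    unfolding smooth_iff_n_smooth g_def gauss_def bump_def diff_conv_add_uminus divide_inverse
      mult_minus_right[symmetric] minus_mult_left
    by (intro allI n_smooth_mult n_smooth_add n_smooth_const n_smooth_exp n_smooth_flat n_smooth_norm_power2
        n_smooth_linear_image[OF bounded_linear_minus])
  have supp: "g n y = 0" if "real (Suc n) \<le> norm y" for n y
  proof -
    have "(real (Suc n))\<^sup>2 \<le> (norm y)\<^sup>2" using that by (intro power_mono) auto
    then have "1 - (norm y)\<^sup>2 / (real (Suc n))\<^sup>2 \<le> 0" by (simp add: field_simps)
    then show ?thesis unfolding g_def bump_def flat_def by simp
  qed
  have [measurable]: "g n \<in> borel_measurable borel" for n
    by (rule borel_measurable_continuous_onI[OF smooth_continuous_on[OF smooth]])
  have chi_lim: "(\<lambda>n. bump n y) \<longlonglongrightarrow> 1" for y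
  proof -
    have l: "(\<lambda>n. 1 - (norm y)\<^sup>2 / (real (Suc n))\<^sup>2) \<longlonglongrightarrow> 1 - 0"
      by (intro tendsto_diff tendsto_const real_tendsto_divide_at_top[where c="(norm y)\<^sup>2"]
          filterlim_pow_at_top filterlim_compose[OF filterlim_real_sequentially filterlim_Suc]) auto
    have "isCont (flat 0) 1" using DERIV_isCont flat_has_derivative by blast
    then have "(\<lambda>n. exp 1 * flat 0 (1 - (norm y)\<^sup>2 / (real (Suc n))\<^sup>2)) \<longlonglongrightarrow> exp 1 * flat 0 1"
      using l by (intro tendsto_mult tendsto_const isCont_tendsto_compose[where g="flat 0"]) auto
    then show ?thesis by (simp add: bump_def flat_def exp_add[symmetric])
  qed
  have "(\<lambda>n. LINT y|lborel. (norm (complex_of_real (g n y) - of_real (gauss b y)))\<^sup>2) \<longlonglongrightarrow> (LINT y|(lborel::(real^'n) measure). 0)"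
  proof (rule integral_dominated_convergence[where w="\<lambda>y. (gauss b y)\<^sup>2"])
    show "AE y in lborel. (\<lambda>n. (norm (complex_of_real (g n y) - of_real (gauss b y)))\<^sup>2) \<longlonglongrightarrow> 0"
      unfolding g_def by (intro AE_I2) (auto intro!: tendsto_eq_intros chi_lim)
    have "(norm (complex_of_real (g n y) - of_real (gauss b y)))\<^sup>2 \<le> (gauss b y)\<^sup>2" for n y
    proof -
      have "norm (complex_of_real (g n y) - of_real (gauss b y)) = gauss b y * (1 - bump n y)"
        using chi01[of n y] gauss_nonneg[of b y]
        unfolding of_real_diff[symmetric] norm_of_real g_def
        by (simp add: algebra_simps mult_left_le)
      also have "\<dots> \<le> gauss b y"
        using chi01[of n y] gauss_nonneg[of b y] by (simp add: mult_left_le)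
      finally show ?thesis by (intro power_mono) auto
    qed
    then show "AE y in lborel. norm ((norm (complex_of_real (g n y) - of_real (gauss b y)))\<^sup>2) \<le> (gauss b y)\<^sup>2" for n
      by (intro AE_I2) simp
  qed (use gauss_normalized(1)[OF b] in auto)
  then have "(\<lambda>n. L2_norm (\<lambda>y. of_real (g n y) - of_real (gauss b y))) \<longlonglongrightarrow> 0"
    unfolding L2_norm_def using tendsto_real_sqrt by fastforce
  then have "\<forall>\<^sub>F n in sequentially. L2_norm (\<lambda>y. of_real (g n y) - of_real (gauss b y)) < e"
    using e by (rule order_tendstoD(2))
  then obtain n where "L2_norm (\<lambda>y. of_real (g n y) - of_real (gauss b y)) < e"
    by (meson eventually_sequentially order_refl)
  then show ?thesis using smooth[of n] supp[of n] by blast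
qed

section \<open>Potentials with bounded second derivatives\<close>

definition gradient :: "(real^'n::finite \<Rightarrow> real) \<Rightarrow> real^'n \<Rightarrow> real^'n" where
  "gradient V x = (\<chi> j. partials [j] V x)"

lemma smooth_has_derivative_gradient:
  assumes "smooth V"
  shows "(V has_derivative (\<lambda>h. gradient V x \<bullet> h)) (at x)"
  using has_derivative_sum_partials[OF smooth_differentiable[OF assms], of x]
  by (simp add: gradient_def inner_vec_def mult.commute)

text \<open>
  The Hessian is made to act on the fixed vector \<open>w\<close>, not on the increment \<open>h\<close>, because that is the form
  in which its operator norm bounds the derivative.
\<close>

lemma gradient_inner_has_derivative:
  assumes "smooth V"
  shows "((\<lambda>x. w \<bullet> gradient V x) has_derivative (\<lambda>h. h \<bullet> (hessian V x *v w))) (at x)"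
proof -
  have "((\<lambda>x. \<Sum>j\<in>UNIV. w $ j * partials [j] V x) has_derivative
      (\<lambda>h. \<Sum>j\<in>UNIV. w $ j * (\<Sum>i\<in>UNIV. (h $ i) *\<^sub>R partials [i] (partials [j] V) x))) (at x)"
    by (intro has_derivative_sum has_derivative_mult_right has_derivative_sum_partials
        smooth_differentiable smooth_partials assms)
  moreover have "(\<Sum>j\<in>UNIV. w $ j * (\<Sum>i\<in>UNIV. (h $ i) *\<^sub>R partials [i] (partials [j] V) x))
      = h \<bullet> (hessian V x *v w)" for h
    unfolding inner_vec_def matrix_vector_mult_def hessian_def real_scaleR_def inner_real_def
      vec_lambda_beta sum_distrib_left
    by (subst sum.swap) (simp add: mult_ac)
  ultimately show ?thesis
    by (simp add: gradient_def inner_vec_def)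
qed

lemma hessian_sup_norm_bound:
  assumes "admissible_potential V"
  shows "norm (hessian V x *v w) \<le> hessian_sup_norm V * norm w" and "0 \<le> hessian_sup_norm V"
proof -
  have "\<exists>B. \<forall>x. \<bar>partials [i, j] V x\<bar> \<le> B" for i j
  proof -
    have "bounded (range (partials [i, j] V))"
      using assms[unfolded admissible_potential_def, THEN conjunct2, rule_format, of "[i, j]"]
      by (simp del: partials.simps)
    then show ?thesis by (auto simp: bounded_iff simp del: partials.simps)
  qed
  then obtain B where B: "\<bar>partials [i, j] V x\<bar> \<le> B i j" for i j x by metis
  have "onorm (\<lambda>v. hessian V x *v v) \<le> (\<Sum>i\<in>UNIV. \<Sum>j\<in>UNIV. B i j)" for x
    by (rule order_trans[OF onorm_le_matrix_component_sum]) (intro sum_mono, simp add: hessian_def B del: partials.simps)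
  then have "bdd_above (range (\<lambda>x. onorm (\<lambda>v. hessian V x *v v)))" by (intro bdd_aboveI) auto
  then have le: "onorm (\<lambda>v. hessian V x *v v) \<le> hessian_sup_norm V" for x
    unfolding hessian_sup_norm_def by (rule cSUP_upper[OF UNIV_I])
  have bl: "bounded_linear (\<lambda>v. hessian V x *v v)" for x by (rule matrix_vector_mul_bounded_linear)
  show "0 \<le> hessian_sup_norm V" using le onorm_pos_le[OF bl] order_trans by blast
  show "norm (hessian V x *v w) \<le> hessian_sup_norm V * norm w"
    by (rule order_trans[OF onorm[OF bl]]) (intro mult_right_mono le norm_ge_zero)
qed

text \<open>
  The mean value inequality for the scalar function \<open>w \<bullet> \<nabla>V\<close>, where \<open>w\<close> is the difference of gradients
  to be estimated.
\<close>

lemma gradient_lipschitz: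
  assumes V: "admissible_potential V"
  shows "norm (gradient V x - gradient V y) \<le> hessian_sup_norm V * norm (x - y)"
proof -
  let ?M = "hessian_sup_norm V"
  define w where "w = gradient V x - gradient V y"
  have sm: "smooth V" using V by (simp add: admissible_potential_def)
  have "norm (w \<bullet> gradient V x - w \<bullet> gradient V y) \<le> (?M * norm w) * norm (x - y)"
  proof (rule differentiable_bound[OF convex_UNIV])
    show "((\<lambda>x. w \<bullet> gradient V x) has_derivative (\<lambda>h. h \<bullet> (hessian V z *v w))) (at z within UNIV)" for z
      using gradient_inner_has_derivative[OF sm] by simp
    show "onorm (\<lambda>h. h \<bullet> (hessian V z *v w)) \<le> ?M * norm w" for z
    proof (rule onorm_bound)
      show "0 \<le> ?M * norm w" using hessian_sup_norm_bound(2)[OF V] by simp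
      show "norm (h \<bullet> (hessian V z *v w)) \<le> ?M * norm w * norm h" for h
        using Cauchy_Schwarz_ineq2[of h "hessian V z *v w"]
          mult_left_mono[OF hessian_sup_norm_bound(1)[OF V, of z w] norm_ge_zero[of h]]
        by (simp add: mult_ac)
    qed
  qed auto
  then have "norm w * norm w \<le> norm w * (?M * norm (x - y))"
    by (simp add: w_def inner_diff_right[symmetric] dot_square_norm power2_eq_square mult_ac)
  then show ?thesis
    using hessian_sup_norm_bound(2)[OF V] unfolding w_def[symmetric]
    by (cases "w = 0") auto
qed

text \<open>
  The linear part of the potential is taken at a point \<open>r\<close> that is merely within distance \<open>1\<close> of the base
  point \<open>q\<close>. This costs only the extra summand \<open>1\<close> and is what permits approximate classical
  trajectories.
\<close>

lemma affine_approximation_error: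
  assumes V: "admissible_potential V" and r: "norm (r - q) \<le> 1"
  shows "\<bar>V q - V x + gradient V r \<bullet> (x - q)\<bar>
    \<le> hessian_sup_norm V * (norm (x - q) + 1) * norm (x - q)"
proof -
  let ?M = "hessian_sup_norm V"
  have sm: "smooth V" using V by (simp add: admissible_potential_def)
  have "norm ((V x - gradient V r \<bullet> x) - (V q - gradient V r \<bullet> q)) \<le> (?M * (norm (x - q) + 1)) * norm (x - q)"
  proof (rule differentiable_bound[where S="closed_segment q x"])
    show "((\<lambda>x. V x - gradient V r \<bullet> x) has_derivative (\<lambda>h. (gradient V z - gradient V r) \<bullet> h))
        (at z within closed_segment q x)" for z
      by (rule has_derivative_at_withinI)
        (auto intro!: derivative_eq_intros smooth_has_derivative_gradient[OF sm] simp: inner_diff_left)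
    show "onorm (\<lambda>h. (gradient V z - gradient V r) \<bullet> h) \<le> ?M * (norm (x - q) + 1)"
      if z: "z \<in> closed_segment q x" for z
    proof (rule onorm_bound)
      have "norm (z - r) \<le> norm (z - q) + norm (r - q)"
        using norm_triangle_ineq4[of "z - q" "r - q"] by simp
      also have "\<dots> \<le> norm (x - q) + 1"
        using segment_bound(1)[OF z] r by simp
      finally have "norm (gradient V z - gradient V r) \<le> ?M * (norm (x - q) + 1)"
        by (intro order_trans[OF gradient_lipschitz[OF V]] mult_left_mono hessian_sup_norm_bound(2)[OF V])
      then show "norm ((gradient V z - gradient V r) \<bullet> h) \<le> ?M * (norm (x - q) + 1) * norm h" for h
        by (intro order_trans[OF Cauchy_Schwarz_ineq2, unfolded real_norm_def[symmetric]] mult_right_mono) auto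
      show "0 \<le> ?M * (norm (x - q) + 1)" using hessian_sup_norm_bound(2)[OF V] by simp
    qed
  qed auto
  then show ?thesis by (simp add: inner_diff_right abs_minus_commute algebra_simps)
qed

section \<open>Approximate classical trajectories\<close>

lemma integral_has_vector_derivative_interior:
  fixes f :: "real \<Rightarrow> 'a::banach"
  assumes "f integrable_on {a..b}" "t \<in> {a<..<b}" "continuous (at t within {a..b}) f"
  shows "((\<lambda>u. integral {a..u} f) has_vector_derivative f t) (at t)"
  using integral_has_vector_derivative_continuous_at[of f a b t "{}"] assms
  by (simp add: at_within_Icc_at)

text \<open>
  Newton's equation \<open>q'' = e - G(q)\<close>, except that the force is evaluated along a curve \<open>r\<close> that stays
  within distance \<open>1\<close> of \<open>q\<close>. Such a pair is formed by two consecutive Picard iterates. On \<open>[0, T]\<close> with \<open>M T\<^sup>2 \<le> 1/2\<close> the Picard map is a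
  contraction with factor \<open>1/2\<close> in the supremum norm, so consecutive iterates become as close as
  desired. The tolerance does not depend on \<open>e\<close>, however large \<open>e\<close> is.
\<close>

lemma approximate_trajectory:
  fixes e :: "real \<Rightarrow> 'a::euclidean_space"
  assumes T: "0 \<le> T" and e: "e integrable_on {0..T}"
    and lip: "\<And>x y. norm (G x - G y) \<le> M * norm (x - y)" and M: "0 \<le> M" "M * T\<^sup>2 \<le> 1 / 2"
  obtains p q r where "continuous_on {0..T} p" "continuous_on {0..T} q" "continuous_on {0..T} r"
    "p 0 = v0" "q 0 = x0" "\<And>t. t \<in> {0..T} \<Longrightarrow> norm (r t - q t) \<le> 1"
    "\<And>t. t \<in> {0<..<T} \<Longrightarrow> continuous (at t within {0..T}) e \<Longrightarrow>
       (p has_vector_derivative e t - G (r t)) (at t)"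
    "\<And>t. t \<in> {0<..<T} \<Longrightarrow> (q has_vector_derivative p t) (at t)"
proof -
  have contG: "continuous_on UNIV G"
  proof (rule lipschitz_on_continuous_on)
    show "M-lipschitz_on UNIV G" using lip M by (auto intro!: lipschitz_onI simp: dist_norm)
  qed
  define P where "P r t = v0 + integral {0..t} (\<lambda>s. e s - G (r s))" for r t
  define Q where "Q r t = x0 + integral {0..t} (P r)" for r t
  define R where "R n = (Q ^^ n) (\<lambda>_. x0)" for n
  have R_Suc: "R (Suc n) = Q (R n)" for n by (simp add: R_def)
  have intG: "(\<lambda>s. G (r s)) integrable_on {0..T}" if "continuous_on {0..T} r" for r
    by (intro integrable_continuous_real continuous_on_compose2[OF contG that]) auto
  have intP: "(\<lambda>s. e s - G (r s)) integrable_on {0..T}" if "continuous_on {0..T} r" for r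
    by (intro integrable_diff e intG that)
  have contP: "continuous_on {0..T} (P r)" if "continuous_on {0..T} r" for r
    unfolding P_def by (intro continuous_intros indefinite_integral_continuous_1 intP that)
  have contQ: "continuous_on {0..T} (Q r)" if "continuous_on {0..T} r" for r
    unfolding Q_def by (intro continuous_intros indefinite_integral_continuous_1 integrable_continuous_real contP that)
  have contR: "continuous_on {0..T} (R n)" for n
    by (induction n) (auto simp: R_Suc contQ, simp add: R_def)
  have contraction: "norm (Q r t - Q r' t) \<le> D / 2"
    if r: "continuous_on {0..T} r" "continuous_on {0..T} r'"
      and D: "\<And>s. s \<in> {0..T} \<Longrightarrow> norm (r s - r' s) \<le> D" and t: "t \<in> {0..T}" for r r' D t
  proof -
    have D0: "0 \<le> D" using order_trans[OF norm_ge_zero D[of 0]] T by simp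
    have sub: "{0..s} \<subseteq> {0..T}" if "s \<in> {0..T}" for s using that by auto
    have bP: "norm (P r s - P r' s) \<le> M * D * T" if s: "s \<in> {0..T}" for s
    proof -
      have "P r s - P r' s = integral {0..s} (\<lambda>u. (e u - G (r u)) - (e u - G (r' u)))"
        unfolding P_def
        by (subst Henstock_Kurzweil_Integration.integral_diff)
          (auto intro: integrable_on_subinterval[OF intP sub[OF s]] r)
      also have "norm \<dots> \<le> M * D * (s - 0)"
      proof (rule integral_bound)
        show "continuous_on {0..s} (\<lambda>u. (e u - G (r u)) - (e u - G (r' u)))"
          by (simp, intro continuous_intros continuous_on_compose2[OF contG]
              continuous_on_subset[OF r(1) sub[OF s]] continuous_on_subset[OF r(2) sub[OF s]]) auto
        show "norm ((e u - G (r u)) - (e u - G (r' u))) \<le> M * D" if "u \<in> {0..s}" for u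
          using order_trans[OF lip[of "r' u" "r u"] mult_left_mono[OF D[of u] M(1), unfolded norm_minus_commute[of "r u"]]]
            that s by auto
      qed (use s in auto)
      also have "\<dots> \<le> M * D * T" using s D0 M by (intro mult_left_mono) auto
      finally show ?thesis .
    qed
    have "Q r t - Q r' t = integral {0..t} (\<lambda>s. P r s - P r' s)"
      unfolding Q_def
      by (subst Henstock_Kurzweil_Integration.integral_diff)
        (auto intro!: integrable_continuous_real continuous_on_subset[OF contP sub[OF t]] r)
    also have "norm \<dots> \<le> M * D * T * (t - 0)"
      by (rule integral_bound)
        (use t sub[OF t] bP in \<open>auto intro!: continuous_intros continuous_on_subset[OF contP sub[OF t]] r\<close>)
    also have "\<dots> \<le> M * D * T * T" using t T D0 M by (intro mult_left_mono) auto
    also have "\<dots> = (M * T\<^sup>2) * D" by (simp add: power2_eq_square mult_ac)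
    also have "\<dots> \<le> 1 / 2 * D" using M D0 by (intro mult_right_mono) auto
    finally show ?thesis by simp
  qed
  have "bounded ((\<lambda>t. R 1 t - R 0 t) ` {0..T})"
    by (intro compact_imp_bounded compact_continuous_image continuous_intros contR) auto
  then obtain D where D: "\<And>t. t \<in> {0..T} \<Longrightarrow> norm (R 1 t - R 0 t) \<le> D"
    unfolding bounded_iff by blast
  have Dn: "t \<in> {0..T} \<Longrightarrow> norm (R (Suc n) t - R n t) \<le> D / 2 ^ n" for n t
  proof (induction n arbitrary: t)
    case (Suc n)
    show ?case using contraction[OF contR contR Suc.IH Suc.prems] by (simp add: R_Suc mult.commute)
  qed (use D in simp)
  obtain n where n: "D < 2 ^ n" using real_arch_pow[of 2 D] by auto
  show thesis
  proof (rule that[of "P (R n)" "Q (R n)" "R n"])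
    show "norm (R n t - Q (R n) t) \<le> 1" if "t \<in> {0..T}" for t
    proof -
      have "D / 2 ^ n \<le> 1" using n by simp
      from order_trans[OF Dn[OF that, of n] this] show ?thesis
        by (simp add: R_Suc norm_minus_commute)
    qed
    show "(P (R n) has_vector_derivative e t - G (R n t)) (at t)"
      if t: "t \<in> {0<..<T}" and ct: "continuous (at t within {0..T}) e" for t
    proof -
      have "continuous (at t within {0..T}) (\<lambda>s. e s - G (R n s))"
        using continuous_on_compose2[OF contG contR[of n]] t ct
        by (intro continuous_intros) (auto simp: continuous_on_eq_continuous_within)
      from integral_has_vector_derivative_interior[OF intP[OF contR] t this]
      show ?thesis unfolding P_def by (auto intro!: derivative_eq_intros)
    qed
    show "(Q (R n) has_vector_derivative P (R n) t) (at t)" if t: "t \<in> {0<..<T}" for t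
    proof -
      have "continuous (at t within {0..T}) (P (R n))"
        using contP[OF contR[of n]] t by (auto simp: continuous_on_eq_continuous_within)
      from integral_has_vector_derivative_interior[OF integrable_continuous_real[OF contP[OF contR]] t this]
      show ?thesis unfolding Q_def by (auto intro!: derivative_eq_intros)
    qed
  qed (auto simp: contP contQ contR, simp_all add: P_def Q_def)
qed

text \<open>
  One-sided limits bound the control near every point, so compactness bounds it on the interval;
  measurability follows from continuity off a finite set.
\<close>

lemma piecewise_continuous_integrable:
  fixes E :: "real \<Rightarrow> real^'n::finite"
  assumes "piecewise_continuous a b E"
  shows "E integrable_on {a..b}"
proof -
  obtain F where F: "finite F" "\<And>t. t \<in> {a..b} - F \<Longrightarrow> continuous (at t within {a..b}) E"
    "\<And>t. t \<in> F \<inter> {a..b} \<Longrightarrow> a < t \<Longrightarrow> \<exists>l. (E \<longlongrightarrow> l) (at_left t)"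
    "\<And>t. t \<in> F \<inter> {a..b} \<Longrightarrow> t < b \<Longrightarrow> \<exists>l. (E \<longlongrightarrow> l) (at_right t)"
    using assms unfolding piecewise_continuous_def by blast
  \<comment> \<open>The one-sided limits at \<open>t\<close> exist whether or not \<open>t\<close> is one of the exceptional points.\<close>
  have locally_bounded: "\<exists>S B. open S \<and> t \<in> S \<and> (\<forall>s\<in>S \<inter> {a..b}. norm (E s) \<le> B)"
    if t: "t \<in> {a..b}" for t
  proof -
    have near: "\<exists>B. \<forall>\<^sub>F s in net. norm (E s) \<le> B" if "(E \<longlongrightarrow> l) net" for l net
    proof -
      have "\<forall>\<^sub>F s in net. norm (E s) < norm l + 1"
        by (rule order_tendstoD(2)[OF tendsto_norm[OF that]]) simp
      then have "\<forall>\<^sub>F s in net. norm (E s) \<le> norm l + 1" by eventually_elim simp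
      then show ?thesis by blast
    qed
    have l: "\<exists>B. \<forall>\<^sub>F s in at_left t. s \<in> {a..b} \<longrightarrow> norm (E s) \<le> B"
    proof (cases "a < t")
      case True
      have "\<exists>l. (E \<longlongrightarrow> l) (at_left t)"
      proof (cases "t \<in> F")
        case False
        have "(E \<longlongrightarrow> E t) (at t within {a..t})"
          using F(2)[of t] t False unfolding continuous_within
          by (auto elim: tendsto_within_subset)
        then show ?thesis using True by (auto simp: at_within_Icc_at_left)
      qed (use F(3) t True in auto)
      with near obtain B where "\<forall>\<^sub>F s in at_left t. norm (E s) \<le> B" by blast
      then show ?thesis by (auto elim: eventually_mono)
    next
      case False
      then have "\<forall>\<^sub>F s in at_left t. s \<in> {a..b} \<longrightarrow> norm (E s) \<le> 0"
        using t by (auto simp: eventually_at_filter intro!: always_eventually)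
      then show ?thesis by blast
    qed
    have r: "\<exists>B. \<forall>\<^sub>F s in at_right t. s \<in> {a..b} \<longrightarrow> norm (E s) \<le> B"
    proof (cases "t < b")
      case True
      have "\<exists>l. (E \<longlongrightarrow> l) (at_right t)"
      proof (cases "t \<in> F")
        case False
        have "(E \<longlongrightarrow> E t) (at t within {t..b})"
          using F(2)[of t] t False unfolding continuous_within
          by (auto elim: tendsto_within_subset)
        then show ?thesis using True by (auto simp: at_within_Icc_at_right)
      qed (use F(4) t True in auto)
      with near obtain B where "\<forall>\<^sub>F s in at_right t. norm (E s) \<le> B" by blast
      then show ?thesis by (auto elim: eventually_mono)
    next
      case False
      then have "\<forall>\<^sub>F s in at_right t. s \<in> {a..b} \<longrightarrow> norm (E s) \<le> 0"
        using t by (auto simp: eventually_at_filter intro!: always_eventually)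
      then show ?thesis by blast
    qed
    from l r obtain B1 B2 where "\<forall>\<^sub>F s in at_left t. s \<in> {a..b} \<longrightarrow> norm (E s) \<le> B1"
      "\<forall>\<^sub>F s in at_right t. s \<in> {a..b} \<longrightarrow> norm (E s) \<le> B2" by blast
    then have "\<forall>\<^sub>F s in at t. s \<in> {a..b} \<longrightarrow> norm (E s) \<le> max B1 B2"
      unfolding eventually_at_split by (auto elim!: eventually_mono)
    then obtain S where S: "open S" "t \<in> S"
      "\<And>s. s \<in> S \<Longrightarrow> s \<noteq> t \<Longrightarrow> s \<in> {a..b} \<Longrightarrow> norm (E s) \<le> max B1 B2"
      unfolding eventually_at_topological by blast
    have "norm (E s) \<le> max (max B1 B2) (norm (E t))" if "s \<in> S \<inter> {a..b}" for s
      using S(3)[of s] that by (cases "s = t") auto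
    then show ?thesis using S(1,2) by blast
  qed
  then obtain S B where SB: "\<And>t. t \<in> {a..b} \<Longrightarrow> open (S t) \<and> t \<in> S t \<and> (\<forall>s\<in>S t \<inter> {a..b}. norm (E s) \<le> B t)"
    by metis
  obtain I where I: "I \<subseteq> {a..b}" "finite I" "{a..b} \<subseteq> (\<Union>t\<in>I. S t)"
    by (rule compactE_image[of "{a..b}" "{a..b}" S]) (use SB in blast)+
  have bnd: "norm (E s) \<le> (\<Sum>t\<in>I. \<bar>B t\<bar>)" if s: "s \<in> {a..b}" for s
  proof -
    obtain t where t: "t \<in> I" "s \<in> S t" using I s by blast
    then have "norm (E s) \<le> \<bar>B t\<bar>" using SB[of t] I s by force
    also have "\<dots> \<le> (\<Sum>t\<in>I. \<bar>B t\<bar>)" using t I by (intro member_le_sum) auto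
    finally show ?thesis .
  qed
  have meas: "{a..b} - F \<in> sets lebesgue"
    using F(1) by (intro sets.Diff sets_completionI_sets) (auto intro: borel_closed finite_imp_closed)
  have "E absolutely_integrable_on ({a..b} - F)"
  proof (rule measurable_bounded_by_integrable_imp_absolutely_integrable)
    have "continuous_on ({a..b} - F) E"
      unfolding continuous_on_eq_continuous_within
      by (intro ballI continuous_within_subset[OF F(2)]) auto
    then show "E \<in> borel_measurable (lebesgue_on ({a..b} - F))"
      by (intro continuous_imp_measurable_on_sets_lebesgue meas)
    have "(\<lambda>_. \<Sum>t\<in>I. \<bar>B t\<bar>) integrable_on {a..b}" by (rule integrable_const_ivl)
    then show "(\<lambda>_. \<Sum>t\<in>I. \<bar>B t\<bar>) integrable_on ({a..b} - F)"
      using F(1) by (auto intro: integrable_spike_set simp: negligible_finite intro: negligible_subset)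
  qed (use bnd meas in auto)
  then have "E integrable_on ({a..b} - F)" by (simp add: set_lebesgue_integral_eq_integral)
  then show ?thesis
    by (rule integrable_spike_set) (use F(1) in \<open>auto intro: negligible_subset[OF negligible_finite[OF F(1)]]\<close>)
qed

section \<open>Wave packets\<close>

text \<open>
  The profile \<open>g\<close> moved to position \<open>q\<close> with momentum \<open>p\<close>. The phase is written \<open>\<theta> + p \<bullet> x\<close> and not
  \<open>\<theta> + p \<bullet> (x - q)\<close>: with this choice the equation for \<open>\<theta>\<close> along a classical trajectory does not
  contain the control, so \<open>\<theta>\<close> is continuously differentiable although the control may jump.
\<close>

definition packet ::
    "(real^'n::finite \<Rightarrow> real) \<Rightarrow> real \<Rightarrow> real^'n \<Rightarrow> real^'n \<Rightarrow> real^'n \<Rightarrow> complex" where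
  "packet g \<theta> p q x = exp (\<i> * of_real (\<theta> + p \<bullet> x)) * of_real (g (x - q))"

lemma norm_packet: "norm (packet g \<theta> p q x) = \<bar>g (x - q)\<bar>"
  by (simp add: packet_def norm_mult)

lemma packet_has_derivative:
  assumes "smooth g"
  shows "(packet g \<theta> p q has_derivative (\<lambda>h. \<i> * of_real (p \<bullet> h) * packet g \<theta> p q x
    + (\<Sum>i\<in>UNIV. of_real (h $ i) * packet (partials [i] g) \<theta> p q x))) (at x)"
proof -
  have "((\<lambda>x. \<i> * complex_of_real (\<theta> + p \<bullet> x)) has_derivative (\<lambda>h. \<i> * of_real (p \<bullet> h))) (at x)"
    by (auto intro!: derivative_eq_intros)
  from has_derivative_compose[OF this DERIV_exp[unfolded has_field_derivative_def]]
  have 1: "((\<lambda>x. exp (\<i> * complex_of_real (\<theta> + p \<bullet> x))) has_derivative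
      (\<lambda>h. exp (\<i> * of_real (\<theta> + p \<bullet> x)) * (\<i> * of_real (p \<bullet> h)))) (at x)" .
  have "((\<lambda>x. x - q) has_derivative (\<lambda>h. h)) (at x)" by (auto intro!: derivative_eq_intros)
  from has_derivative_compose[OF this has_derivative_sum_partials[OF smooth_differentiable[OF assms]]]
  have 2: "((\<lambda>x. complex_of_real (g (x - q))) has_derivative
      (\<lambda>h. of_real (\<Sum>i\<in>UNIV. (h $ i) *\<^sub>R partials [i] g (x - q)))) (at x)"
    by (rule bounded_linear.has_derivative[OF bounded_linear_of_real])
  show ?thesis
    using has_derivative_mult[OF 1 2] unfolding packet_def[abs_def]
    by (rule has_derivative_eq_rhs) (simp add: fun_eq_iff sum_distrib_left algebra_simps)
qed

lemma partials_packet: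
  assumes "smooth g"
  shows "partials [i] (packet g \<theta> p q) =
    (\<lambda>x. \<i> * of_real (p $ i) * packet g \<theta> p q x + packet (partials [i] g) \<theta> p q x)"
proof -
  have "(\<Sum>j\<in>UNIV. complex_of_real (axis i 1 $ j) * c j) = c i" for c
    by (subst sum.remove[of _ i]) (auto simp: axis_def intro!: sum.neutral)
  then show ?thesis
    unfolding partial_eqI[OF packet_has_derivative[OF assms]] by (simp add: inner_axis)
qed

lemma packet_sum: "packet (\<lambda>y. \<Sum>i\<in>I. f i y) \<theta> p q x = (\<Sum>i\<in>I. packet (f i) \<theta> p q x)"
  by (simp add: packet_def sum_distrib_left)

text \<open>
  Every derivative falls either on the phase, where it produces a factor \<open>\<i> p\<close>, or on the profile, where
  it produces a packet with a differentiated profile.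
\<close>

lemma laplacian_packet:
  assumes g: "smooth g"
  shows "laplacian (packet g \<theta> p q) x = - of_real (p \<bullet> p) * packet g \<theta> p q x
    + 2 * \<i> * (\<Sum>i\<in>UNIV. of_real (p $ i) * packet (partials [i] g) \<theta> p q x)
    + packet (\<lambda>y. \<Sum>i\<in>UNIV. partials [i, i] g y) \<theta> p q x"
proof -
  have "partials [i, i] (packet g \<theta> p q) x = - of_real (p $ i * p $ i) * packet g \<theta> p q x
      + 2 * \<i> * (of_real (p $ i) * packet (partials [i] g) \<theta> p q x)
      + packet (partials [i, i] g) \<theta> p q x" for i
  proof -
    let ?d = "\<lambda>f y h. \<i> * of_real (p \<bullet> h) * packet f \<theta> p q y
        + (\<Sum>j\<in>UNIV. of_real (h $ j) * packet (partials [j] f) \<theta> p q y)"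
    have "partials [i, i] (packet g \<theta> p q) = partials [i] (partials [i] (packet g \<theta> p q))" by simp
    also have "partials [i] (packet g \<theta> p q) =
        (\<lambda>x. \<i> * of_real (p $ i) * packet g \<theta> p q x + packet (partials [i] g) \<theta> p q x)"
      by (rule partials_packet[OF g])
    also have "partials [i] \<dots> = (\<lambda>x. \<i> * of_real (p $ i) * ?d g x (axis i 1)
        + ?d (partials [i] g) x (axis i 1))"
      by (rule partial_eqI)
        (intro has_derivative_add has_derivative_mult_right packet_has_derivative g smooth_partials)
    also have "\<dots> = (\<lambda>x. \<i> * of_real (p $ i) * partials [i] (packet g \<theta> p q) x
        + partials [i] (packet (partials [i] g) \<theta> p q) x)"
      unfolding partial_eqI[OF packet_has_derivative[OF g]]
        partial_eqI[OF packet_has_derivative[OF smooth_partials[OF g]]] ..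
    finally show ?thesis
      unfolding partials_packet[OF g] partials_packet[OF smooth_partials[OF g]]
      by (simp add: algebra_simps)
  qed
  then show ?thesis
    unfolding laplacian_def packet_sum inner_vec_def
    by (simp add: sum.distrib sum_distrib_left sum_distrib_right sum_negf sum_subtractf del: partials.simps)
qed

lemma smooth_packet:
  assumes g: "smooth g" shows "smooth (packet g \<theta> p q)"
proof -
  have "n_smooth n (\<lambda>x. complex_of_real (g (x - q)))" for n
    by (rule n_smooth_linear_image[OF bounded_linear_of_real], rule n_smooth_translate)
      (use g in \<open>simp add: smooth_iff_n_smooth\<close>)
  moreover have "n_smooth n (\<lambda>x. exp (\<i> * complex_of_real (\<theta> + p \<bullet> x)))" for n
    by (intro n_smooth_exp n_smooth_mult n_smooth_const n_smooth_add
        n_smooth_linear_image[OF bounded_linear_of_real]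
        n_smooth_bounded_linear bounded_linear_inner_right)
  ultimately show ?thesis
    unfolding smooth_iff_n_smooth packet_def[abs_def] by (intro allI n_smooth_mult)
qed

lemma test_function_packet:
  assumes "smooth g" and supp: "\<And>y. R < norm y \<Longrightarrow> g y = 0"
  shows "test_function (packet g \<theta> p q)"
proof -
  have "{x. packet g \<theta> p q x \<noteq> 0} \<subseteq> cball q R"
  proof
    fix x assume "x \<in> {x. packet g \<theta> p q x \<noteq> 0}"
    then have "g (x - q) \<noteq> 0" by (simp add: packet_def)
    then have "\<not> R < norm (x - q)" using supp by blast
    then show "x \<in> cball q R" by (simp add: dist_norm norm_minus_commute)
  qed
  then have "bounded {x. packet g \<theta> p q x \<noteq> 0}" by (rule bounded_subset[OF bounded_cball])
  then show ?thesis using smooth_packet[OF assms(1)] by (simp add: test_function_def)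
qed

lemma smooth_bounded_support_imp_bounded:
  fixes g :: "real^'n::finite \<Rightarrow> real"
  assumes "smooth g" "\<And>y. R < norm y \<Longrightarrow> g y = 0"
  shows "\<exists>B\<ge>0. \<forall>y. \<bar>g y\<bar> \<le> B"
proof -
  have "bounded (g ` cball 0 R)"
    by (intro compact_imp_bounded compact_continuous_image smooth_continuous_on assms(1)) auto
  then obtain B where B: "\<And>x. x \<in> cball 0 R \<Longrightarrow> \<bar>g x\<bar> \<le> B"
    unfolding bounded_iff real_norm_def by blast
  have "\<bar>g x\<bar> \<le> max B 0" for x
    using B[of x] assms(2)[of x] by (cases "norm x \<le> R") auto
  then show ?thesis by (intro exI[of _ "max B 0"]) simp
qed

text \<open>
  The complement of the closed ball is open, so derivatives vanish there as well.
\<close>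

lemma partials_bounded_support:
  fixes g :: "real^'n::finite \<Rightarrow> 'b::real_normed_vector"
  assumes supp: "\<And>y. R < norm y \<Longrightarrow> g y = 0" and y: "R < norm y"
  shows "partials \<alpha> g y = 0"
  using y
proof (induction \<alpha> arbitrary: y)
  case (Cons i \<alpha>)
  have "((\<lambda>_. 0) has_derivative (\<lambda>_. 0)) (at y)" by simp
  then have "(partials \<alpha> g has_derivative (\<lambda>_. 0)) (at y)"
  proof (rule has_derivative_transform_within_open)
    show "open {y :: real^'n. R < norm y}" by (intro open_Collect_less continuous_intros)
  qed (use Cons in auto)
  from frechet_derivative_at[OF this, symmetric] show ?case by simp
qed (use supp in simp)

lemma smooth_bounded_support_lipschitz:
  fixes g :: "real^'n::finite \<Rightarrow> real"
  assumes g: "smooth g" and supp: "\<And>y. R < norm y \<Longrightarrow> g y = 0"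
  obtains L where "0 \<le> L" "\<And>y z. \<bar>g y - g z\<bar> \<le> L * norm (y - z)"
proof -
  have "\<exists>B\<ge>0. \<forall>y. \<bar>partials [i] g y\<bar> \<le> B" for i
    by (rule smooth_bounded_support_imp_bounded[OF smooth_partials[OF g] partials_bounded_support[OF supp]])
  then obtain B where B: "\<And>i. 0 \<le> B i" "\<And>i y. \<bar>partials [i] g y\<bar> \<le> B i" by metis
  have "norm (g y - g z) \<le> (\<Sum>i\<in>UNIV. B i) * norm (y - z)" for y z
  proof (rule differentiable_bound[OF convex_UNIV])
    show "(g has_derivative (\<lambda>h. \<Sum>i\<in>UNIV. (h $ i) *\<^sub>R partials [i] g x)) (at x within UNIV)" for x
      using has_derivative_sum_partials[OF smooth_differentiable[OF g]] by simp
    show "onorm (\<lambda>h. \<Sum>i\<in>UNIV. (h $ i) *\<^sub>R partials [i] g x) \<le> (\<Sum>i\<in>UNIV. B i)" for x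
    proof (rule onorm_bound)
      have "norm ((h $ i) *\<^sub>R partials [i] g x) \<le> B i * norm h" for h :: "real^'n" and i
        using mult_mono[OF component_le_norm_cart[of h i] B(2)[of i x]]
        by (simp add: mult.commute abs_mult del: partials.simps)
      then show "norm (\<Sum>i\<in>UNIV. (h $ i) *\<^sub>R partials [i] g x) \<le> (\<Sum>i\<in>UNIV. B i) * norm h" for h
        unfolding sum_distrib_right by (intro sum_norm_le)
    qed (simp add: B sum_nonneg)
  qed auto
  then show ?thesis using that[of "\<Sum>i\<in>UNIV. B i"] by (auto simp: B sum_nonneg)
qed

lemma norm_cis_diff_le: "norm (exp (\<i> * of_real a) - exp (\<i> * of_real b)) \<le> \<bar>a - b\<bar>"
proof -
  have "exp (\<i> * of_real a) - exp (\<i> * of_real b)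
      = exp (\<i> * of_real b) * (exp (\<i> * of_real (a - b)) - 1)"
    by (simp add: right_diff_distrib exp_diff)
  then have "norm (exp (\<i> * of_real a) - exp (\<i> * of_real b)) = dist (exp (\<i> * of_real (a - b))) 1"
    by (simp add: norm_mult dist_norm)
  also have "\<dots> = 2 * \<bar>sin ((a - b) / 2)\<bar>" unfolding dist_norm by (rule dist_exp_i_1)
  also have "\<dots> \<le> \<bar>a - b\<bar>" using abs_sin_x_le_abs_x[of "(a - b) / 2"] by simp
  finally show ?thesis .
qed

lemma packet_diff_le:
  assumes B: "\<And>y. \<bar>g y\<bar> \<le> B" and L: "\<And>y z. \<bar>g y - g z\<bar> \<le> L * norm (y - z)"
  shows "norm (packet g \<theta> p q x - packet g \<theta>' p' q' x)
    \<le> (\<bar>\<theta> - \<theta>'\<bar> + norm (p - p') * norm x) * B + L * norm (q - q')"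
proof -
  let ?e = "\<lambda>\<theta> p. exp (\<i> * of_real (\<theta> + p \<bullet> x))"
  have "packet g \<theta> p q x - packet g \<theta>' p' q' x
      = (?e \<theta> p - ?e \<theta>' p') * of_real (g (x - q)) + ?e \<theta>' p' * of_real (g (x - q) - g (x - q'))"
    by (simp add: packet_def algebra_simps)
  also have "norm \<dots> \<le> norm (?e \<theta> p - ?e \<theta>' p') * \<bar>g (x - q)\<bar> + \<bar>g (x - q) - g (x - q')\<bar>"
    by (rule norm_triangle_le) (simp add: norm_mult del: of_real_add of_real_diff)
  also have "\<dots> \<le> (\<bar>\<theta> - \<theta>'\<bar> + norm (p - p') * norm x) * B + L * norm (q - q')"
  proof (intro add_mono mult_mono B)
    have "norm (?e \<theta> p - ?e \<theta>' p') \<le> \<bar>(\<theta> + p \<bullet> x) - (\<theta>' + p' \<bullet> x)\<bar>" by (rule norm_cis_diff_le)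
    also have "(\<theta> + p \<bullet> x) - (\<theta>' + p' \<bullet> x) = (\<theta> - \<theta>') + (p - p') \<bullet> x" by (simp add: inner_diff_left)
    also have "\<bar>\<dots>\<bar> \<le> \<bar>\<theta> - \<theta>'\<bar> + norm (p - p') * norm x"
      by (intro order_trans[OF abs_triangle_ineq] add_left_mono Cauchy_Schwarz_ineq2)
    finally show "norm (?e \<theta> p - ?e \<theta>' p') \<le> \<bar>\<theta> - \<theta>'\<bar> + norm (p - p') * norm x" .
    show "\<bar>g (x - q) - g (x - q')\<bar> \<le> L * norm (q - q')"
      using L[of "x - q" "x - q'"] by (simp add: norm_minus_commute)
  qed auto
  finally show ?thesis .
qed

lemma L2_norm_packet:
  assumes "g \<in> borel_measurable borel"
  shows "L2_norm (packet g \<theta> p q) = L2_norm (\<lambda>y. of_real (g y))"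
proof -
  have "L2_norm (packet g \<theta> p q) = L2_norm (\<lambda>x. of_real (g (x - q)))"
    unfolding L2_norm_def norm_packet by simp
  also have "\<dots> = L2_norm (\<lambda>y. of_real (g y))"
    by (rule L2_norm_translate[where f="\<lambda>y. of_real (g y)"]) (use assms in simp)
  finally show ?thesis .
qed

lemma gaussian_state_eq_packet: "gaussian_state b x0 v0 = packet (gauss b) (- (v0 \<bullet> x0)) v0 x0"
  by (simp add: fun_eq_iff gaussian_state_eq packet_def inner_diff_right)

lemma packet_gauss_L2:
  assumes b: "b > 0"
  shows "packet (gauss b) \<theta> p q \<in> L2"
proof (rule L2_dominated[OF gauss_L2[OF b, of q]])
  show "packet (gauss b) \<theta> p q \<in> borel_measurable lborel"
    unfolding packet_def[abs_def] by measurable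
qed (simp add: norm_packet)

text \<open>
  Difference quotients can be paired with another function inside an inner product, which the
  remainder formulation of differentiability does not allow directly.
\<close>

lemma has_vector_derivative_iff_quotient:
  fixes f :: "real \<Rightarrow> 'a::real_normed_vector"
  shows "(f has_vector_derivative D) (at t) \<longleftrightarrow>
    ((\<lambda>s. (1 / (s - t)) *\<^sub>R (f s - f t)) \<longlongrightarrow> D) (at t)"
proof -
  have e: "\<forall>\<^sub>F s in at t. norm (f s - f t - (s - t) *\<^sub>R D) / norm (s - t)
      = norm ((1 / (s - t)) *\<^sub>R (f s - f t) - D)"
  proof (rule eventually_at_topological[THEN iffD2], intro exI[of _ UNIV] conjI ballI impI)
    fix s assume "s \<noteq> t"
    then have "(1 / (s - t)) *\<^sub>R (f s - f t) - D = (1 / (s - t)) *\<^sub>R (f s - f t - (s - t) *\<^sub>R D)"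
      by (simp add: scaleR_diff_right)
    then show "norm (f s - f t - (s - t) *\<^sub>R D) / norm (s - t) = norm ((1 / (s - t)) *\<^sub>R (f s - f t) - D)"
      by (simp add: divide_inverse mult.commute)
  qed auto
  have "(f has_vector_derivative D) (at t) \<longleftrightarrow>
      ((\<lambda>s. norm (f s - f t - (s - t) *\<^sub>R D) / norm (s - t)) \<longlongrightarrow> 0) (at t)"
    unfolding has_vector_derivative_def has_derivative_iff_norm
    by (simp add: bounded_linear_scaleR_left)
  also have "\<dots> \<longleftrightarrow> ((\<lambda>s. norm ((1 / (s - t)) *\<^sub>R (f s - f t) - D)) \<longlongrightarrow> 0) (at t)"
    by (rule tendsto_cong[OF e])
  also have "\<dots> \<longleftrightarrow> ((\<lambda>s. (1 / (s - t)) *\<^sub>R (f s - f t)) \<longlongrightarrow> D) (at t)"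
    by (simp add: tendsto_norm_zero_iff Lim_null[symmetric])
  finally show ?thesis .
qed

lemma packet_L2:
  assumes "smooth g" and "\<And>y. R < norm y \<Longrightarrow> g y = 0"
  shows "packet g \<theta> p q \<in> L2"
proof (rule L2_continuous_bounded_support)
  show "continuous_on UNIV (packet g \<theta> p q)" by (rule smooth_continuous_on[OF smooth_packet[OF assms(1)]])
  show "packet g \<theta> p q x = 0" if "R + norm q < norm x" for x
    using assms(2)[of "x - q"] norm_triangle_ineq2[of x q] that by (simp add: packet_def)
qed

text \<open>
  The time derivative of a packet whose parameters have the velocities \<open>\<theta>'\<close>, \<open>p'\<close> and \<open>q'\<close>.
\<close>

definition packet_velocity ::
    "(real^'n::finite \<Rightarrow> real) \<Rightarrow> real \<Rightarrow> real^'n \<Rightarrow> real^'n \<Rightarrow>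
      real \<Rightarrow> real^'n \<Rightarrow> real^'n \<Rightarrow> real^'n \<Rightarrow> complex" where
  "packet_velocity g \<theta> p q \<theta>' p' q' x = \<i> * of_real (\<theta>' + p' \<bullet> x) * packet g \<theta> p q x
     - (\<Sum>i\<in>UNIV. of_real (q' $ i) * packet (partials [i] g) \<theta> p q x)"

lemma packet_has_vector_derivative:
  assumes g: "smooth g"
    and \<theta>: "(\<theta> has_vector_derivative \<theta>') (at t)"
    and p: "(p has_vector_derivative p') (at t)"
    and q: "(q has_vector_derivative q') (at t)"
  shows "((\<lambda>s. packet g (\<theta> s) (p s) (q s) x) has_vector_derivative
    packet_velocity g (\<theta> t) (p t) (q t) \<theta>' p' q' x) (at t)"
proof -
  have "((\<lambda>s. \<theta> s + p s \<bullet> x) has_vector_derivative (\<theta>' + p' \<bullet> x)) (at t)"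
    by (intro has_vector_derivative_add \<theta> bounded_linear.has_vector_derivative[OF bounded_linear_inner_left p])
  then have "((\<lambda>s. \<i> * complex_of_real (\<theta> s + p s \<bullet> x)) has_vector_derivative
      \<i> * complex_of_real (\<theta>' + p' \<bullet> x)) (at t)"
    by (intro bounded_linear.has_vector_derivative[OF bounded_linear_mult_right]
        bounded_linear.has_vector_derivative[OF bounded_linear_of_real])
  from field_vector_diff_chain_at[OF this DERIV_exp]
  have 1: "((\<lambda>s. exp (\<i> * complex_of_real (\<theta> s + p s \<bullet> x))) has_vector_derivative
      \<i> * complex_of_real (\<theta>' + p' \<bullet> x) * exp (\<i> * complex_of_real (\<theta> t + p t \<bullet> x))) (at t)"
    by (simp add: o_def)
  have "((\<lambda>s. x - q s) has_derivative (\<lambda>h. - (h *\<^sub>R q'))) (at t)"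
    using has_derivative_diff[OF has_derivative_const q[unfolded has_vector_derivative_def], of x] by simp
  from has_derivative_compose[OF this has_derivative_sum_partials[OF smooth_differentiable[OF g]]]
  have "((\<lambda>s. g (x - q s)) has_vector_derivative - (\<Sum>i\<in>UNIV. q' $ i * partials [i] g (x - q t))) (at t)"
    unfolding has_vector_derivative_def
    by (rule has_derivative_eq_rhs) (simp add: fun_eq_iff sum_distrib_left sum_negf mult.assoc)
  then have 2: "((\<lambda>s. complex_of_real (g (x - q s))) has_vector_derivative
      of_real (- (\<Sum>i\<in>UNIV. q' $ i * partials [i] g (x - q t)))) (at t)"
    by (rule bounded_linear.has_vector_derivative[OF bounded_linear_of_real])
  show ?thesis
    using has_vector_derivative_mult[OF 1 2] unfolding packet_def packet_velocity_def
    by (rule has_vector_derivative_eq_rhs) (simp add: sum_distrib_left algebra_simps)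
qed

lemma derivative_imp_Lipschitz_along_sequence:
  fixes f :: "real \<Rightarrow> 'a::real_normed_vector"
  assumes f: "(f has_vector_derivative D) (at t)" and X: "X \<longlonglongrightarrow> t" "\<And>n. X n \<noteq> t"
  shows "\<exists>K\<ge>0. \<forall>n. norm (f (X n) - f t) \<le> K * \<bar>X n - t\<bar>"
proof -
  have "(\<lambda>n. (1 / (X n - t)) *\<^sub>R (f (X n) - f t)) \<longlonglongrightarrow> D"
    using f X unfolding has_vector_derivative_iff_quotient tendsto_at_iff_sequentially o_def by auto
  then have "Bseq (\<lambda>n. (1 / (X n - t)) *\<^sub>R (f (X n) - f t))"
    by (intro convergent_imp_Bseq convergentI)
  then obtain K where "K > 0" "\<And>n. norm ((1 / (X n - t)) *\<^sub>R (f (X n) - f t)) \<le> K"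
    unfolding Bseq_def by blast
  then show ?thesis
    using X(2) by (intro exI[of _ K]) (auto simp: divide_simps split: if_splits)
qed

text \<open>
  Pointwise differentiability is the chain rule. Along a sequence of times the difference quotients of
  the parameters are bounded, which bounds those of the packet on a common ball, so dominated
  convergence upgrades the pointwise derivative to one in \<open>L\<^sup>2\<close>.
\<close>

lemma packet_L2_derivative:
  fixes g :: "real^'n::finite \<Rightarrow> real"
  assumes g: "smooth g" and supp: "\<And>y. R < norm y \<Longrightarrow> g y = 0"
    and \<theta>: "(\<theta> has_vector_derivative \<theta>') (at t)"
    and p: "(p has_vector_derivative p') (at t)"
    and q: "(q has_vector_derivative q') (at t)"
  shows "packet_velocity g (\<theta> t) (p t) (q t) \<theta>' p' q' \<in> L2"
    and "((\<lambda>s. L2_norm (\<lambda>x. of_real (1 / (s - t)) *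
        (packet g (\<theta> s) (p s) (q s) x - packet g (\<theta> t) (p t) (q t) x)
        - packet_velocity g (\<theta> t) (p t) (q t) \<theta>' p' q' x)) \<longlongrightarrow> 0) (at t)"
proof -
  let ?v = "packet_velocity g (\<theta> t) (p t) (q t) \<theta>' p' q'"
  have cont_v: "continuous_on UNIV ?v"
    unfolding packet_velocity_def[abs_def]
    by (intro continuous_intros smooth_continuous_on smooth_packet smooth_partials g)
  have zero_p: "packet (partials \<alpha> g) \<theta> p q x = 0" if "R + norm q < norm x" for \<alpha> \<theta> p q x
    using partials_bounded_support[of R g "x - q", OF supp] norm_triangle_ineq2[of x q] that
    by (simp add: packet_def)
  have zero_v: "?v x = 0" if "R + norm (q t) < norm x" for x
    using zero_p[OF that] zero_p[OF that, of "[]"] by (simp add: packet_velocity_def del: partials.simps(2))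
  show "?v \<in> L2" by (rule L2_continuous_bounded_support[OF cont_v zero_v])
  obtain B where B: "0 \<le> B" "\<And>y. \<bar>g y\<bar> \<le> B"
    using smooth_bounded_support_imp_bounded[OF g supp] by blast
  obtain L where L: "0 \<le> L" "\<And>y z. \<bar>g y - g z\<bar> \<le> L * norm (y - z)"
    using smooth_bounded_support_lipschitz[OF g supp] by blast
  show "((\<lambda>s. L2_norm (\<lambda>x. of_real (1 / (s - t)) *
        (packet g (\<theta> s) (p s) (q s) x - packet g (\<theta> t) (p t) (q t) x) - ?v x)) \<longlongrightarrow> 0) (at t)"
    unfolding tendsto_at_iff_sequentially o_def
  proof (intro allI impI)
    fix X :: "nat \<Rightarrow> real" assume "\<forall>n. X n \<in> UNIV - {t}" and X: "X \<longlonglongrightarrow> t"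
    then have Xt: "X n \<noteq> t" for n by auto
    let ?Q = "\<lambda>n x. of_real (1 / (X n - t)) *
        (packet g (\<theta> (X n)) (p (X n)) (q (X n)) x - packet g (\<theta> t) (p t) (q t) x)"
    obtain K1 where K1: "K1 \<ge> 0" "\<And>n. norm (\<theta> (X n) - \<theta> t) \<le> K1 * \<bar>X n - t\<bar>"
      using derivative_imp_Lipschitz_along_sequence[OF \<theta> X Xt] by blast
    obtain K2 where K2: "K2 \<ge> 0" "\<And>n. norm (p (X n) - p t) \<le> K2 * \<bar>X n - t\<bar>"
      using derivative_imp_Lipschitz_along_sequence[OF p X Xt] by blast
    obtain K3 where K3: "K3 \<ge> 0" "\<And>n. norm (q (X n) - q t) \<le> K3 * \<bar>X n - t\<bar>"
      using derivative_imp_Lipschitz_along_sequence[OF q X Xt] by blast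
    have "Bseq (\<lambda>n. X n - t)"
      by (intro convergent_imp_Bseq convergentI[of _ 0]) (use tendsto_diff[OF X tendsto_const[of t]] in simp)
    then obtain D where D: "\<And>n. \<bar>X n - t\<bar> \<le> D" unfolding Bseq_def by auto
    \<comment> \<open>Radius of a ball that contains the supports of all packets along the sequence.\<close>
    define R' where "R' = R + norm (q t) + K3 * D"
    have qX: "norm (q (X n)) \<le> norm (q t) + K3 * D" for n
      using norm_triangle_ineq[of "q t" "q (X n) - q t"] K3(2)[of n] mult_left_mono[OF D[of n] K3(1)]
      by simp
    have D0: "0 \<le> D" using order_trans[OF abs_ge_zero D] .
    then have qt: "norm (q t) \<le> norm (q t) + K3 * D" using K3(1) by simp
    define C where "C = (K1 + K2 * \<bar>R'\<bar>) * B + L * K3"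
    have C0: "0 \<le> C" unfolding C_def using K1 K2 K3 B L by (intro add_nonneg_nonneg mult_nonneg_nonneg) auto
    have zQ: "?Q n x = 0" if "R' < norm x" for n x
      using that qX[of n] qt zero_p[of "q (X n)" x "[]"] zero_p[of "q t" x "[]"]
      by (simp add: R'_def)
    have bQ: "norm (?Q n x) \<le> C" for n x
    proof (cases "R' < norm x")
      case True
      show ?thesis unfolding zQ[OF True] using C0 by simp
    next
      case False
      let ?d = "\<bar>X n - t\<bar>"
      have "norm (packet g (\<theta> (X n)) (p (X n)) (q (X n)) x - packet g (\<theta> t) (p t) (q t) x)
          \<le> (\<bar>\<theta> (X n) - \<theta> t\<bar> + norm (p (X n) - p t) * norm x) * B + L * norm (q (X n) - q t)"
        by (rule packet_diff_le[OF B(2) L(2)])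
      also have "\<dots> \<le> (K1 * ?d + (K2 * ?d) * \<bar>R'\<bar>) * B + L * (K3 * ?d)"
        using K1(2)[of n] K2 K3 B L False by (intro add_mono mult_mono mult_left_mono mult_right_mono) auto
      also have "\<dots> = C * ?d" by (simp add: C_def algebra_simps)
      finally show ?thesis
        using Xt[of n] by (simp add: norm_mult norm_divide divide_simps del: of_real_diff of_real_divide)
    qed
    have lim: "(\<lambda>n. ?Q n x) \<longlonglongrightarrow> ?v x" for x
      using packet_has_vector_derivative[OF g \<theta> p q, of x] X Xt
      unfolding has_vector_derivative_iff_quotient tendsto_at_iff_sequentially o_def scaleR_conv_of_real
      by auto
    have bv: "norm (?v x) \<le> C" for x
      by (rule LIMSEQ_le_const2[OF tendsto_norm[OF lim]]) (use bQ in auto)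
    have "(\<lambda>n. L2_norm (\<lambda>x. ?Q n x - ?v x)) \<longlonglongrightarrow> 0"
    proof (rule L2_dominated_convergence)
      show "(\<lambda>x. ?Q n x - ?v x) \<in> borel_measurable lborel" for n
        unfolding measurable_lborel2
        by (intro borel_measurable_continuous_onI continuous_on_diff continuous_on_mult
            continuous_on_const cont_v smooth_continuous_on smooth_packet g)
      show "(\<lambda>n. ?Q n x - ?v x) \<longlonglongrightarrow> 0" for x by (rule LIM_zero[OF lim])
      show "norm (?Q n x - ?v x) \<le> C + C" for n x
        by (intro order_trans[OF norm_triangle_ineq4] add_mono bQ bv)
      show "?Q n x - ?v x = 0" if "R' < norm x" for n x
      proof -
        have "R + norm (q t) < norm x"
          using that mult_nonneg_nonneg[OF K3(1) D0] unfolding R'_def by linarith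
        from zero_v[OF this] show ?thesis unfolding zQ[OF that] by simp
      qed
    qed
    then show "(\<lambda>n. L2_norm (\<lambda>x. ?Q n x - ?v x)) \<longlonglongrightarrow> 0" .
  qed
qed

lemma packet_L2_continuous:
  fixes g :: "real^'n::finite \<Rightarrow> real" and \<theta> :: "real \<Rightarrow> real"
  assumes g: "smooth g" and supp: "\<And>y. R < norm y \<Longrightarrow> g y = 0"
    and \<theta>: "(\<theta> \<longlongrightarrow> \<theta> t) (at t within S)"
    and p: "(p \<longlongrightarrow> p t) (at t within S)"
    and q: "(q \<longlongrightarrow> q t) (at t within S)"
  shows "((\<lambda>s. L2_norm (\<lambda>x. packet g (\<theta> s) (p s) (q s) x - packet g (\<theta> t) (p t) (q t) x)) \<longlongrightarrow> 0)
    (at t within S)"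
  unfolding tendsto_at_iff_sequentially o_def
proof (intro allI impI)
  fix X assume XS: "\<forall>n. X n \<in> S - {t}" and X: "X \<longlonglongrightarrow> t"
  have lims: "(\<lambda>n. \<theta> (X n)) \<longlonglongrightarrow> \<theta> t" "(\<lambda>n. p (X n)) \<longlonglongrightarrow> p t" "(\<lambda>n. q (X n)) \<longlonglongrightarrow> q t"
    using \<theta> p q XS X unfolding tendsto_at_iff_sequentially o_def by blast+
  obtain B where B: "0 \<le> B" "\<And>y. \<bar>g y\<bar> \<le> B"
    using smooth_bounded_support_imp_bounded[OF g supp] by blast
  have "Bseq (\<lambda>n. q (X n))" using lims(3) by (intro convergent_imp_Bseq convergentI)
  then obtain D where D: "\<And>n. norm (q (X n)) \<le> D" unfolding Bseq_def by auto
  have Dt: "norm (q t) \<le> D" by (rule LIMSEQ_le_const2[OF tendsto_norm[OF lims(3)]]) (use D in auto)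
  show "(\<lambda>n. L2_norm (\<lambda>x. packet g (\<theta> (X n)) (p (X n)) (q (X n)) x - packet g (\<theta> t) (p t) (q t) x)) \<longlonglongrightarrow> 0"
  proof (rule L2_dominated_convergence)
    show "(\<lambda>x. packet g (\<theta> (X n)) (p (X n)) (q (X n)) x - packet g (\<theta> t) (p t) (q t) x) \<in> borel_measurable lborel" for n
      by (simp, intro borel_measurable_continuous_onI continuous_intros smooth_continuous_on smooth_packet g)
    have gl: "(\<lambda>n. g (x - q (X n))) \<longlonglongrightarrow> g (x - q t)" for x
    proof (rule isCont_tendsto_compose[where g=g])
      show "isCont g (x - q t)" using smooth_differentiable[OF g] differentiable_imp_continuous_within by blast
    qed (intro tendsto_diff tendsto_const lims)
    have "(\<lambda>n. packet g (\<theta> (X n)) (p (X n)) (q (X n)) x) \<longlonglongrightarrow> packet g (\<theta> t) (p t) (q t) x" for x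
      unfolding packet_def by (intro tendsto_mult tendsto_exp tendsto_add tendsto_inner tendsto_of_real tendsto_const lims gl)
    then show "(\<lambda>n. packet g (\<theta> (X n)) (p (X n)) (q (X n)) x - packet g (\<theta> t) (p t) (q t) x) \<longlonglongrightarrow> 0" for x
      by (rule LIM_zero)
    show "norm (packet g (\<theta> (X n)) (p (X n)) (q (X n)) x - packet g (\<theta> t) (p t) (q t) x) \<le> B + B" for n x
      by (intro order_trans[OF norm_triangle_ineq4] add_mono) (simp_all add: norm_packet B)
    show "packet g (\<theta> (X n)) (p (X n)) (q (X n)) x - packet g (\<theta> t) (p t) (q t) x = 0"
      if "R + D < norm x" for n x
      using supp[of "x - q (X n)"] supp[of "x - q t"] norm_triangle_ineq2[of x "q t"]
        norm_triangle_ineq2[of x "q (X n)"] that Dt D[of n] by (simp add: packet_def)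
  qed
qed

section \<open>Overlap of a solution with a moving wave packet\<close>

text \<open>
  A solution of the Schroedinger equation is in general only strongly continuous, so the product rule
  is stated with the derivative of its overlap with the frozen vector \<open>\<eta> t\<close>, which the weak equation
  provides.
\<close>

lemma L2_inner_has_vector_derivative:
  fixes \<eta> \<psi> :: "real \<Rightarrow> real^'n::finite \<Rightarrow> complex"
  assumes L2: "\<And>s. \<eta> s \<in> L2" "\<And>s. \<psi> s \<in> L2" "v \<in> L2"
    and v: "((\<lambda>s. L2_norm (\<lambda>x. of_real (1 / (s - t)) * (\<eta> s x - \<eta> t x) - v x)) \<longlongrightarrow> 0) (at t)"
    and \<psi>: "((\<lambda>s. L2_norm (\<lambda>x. \<psi> s x - \<psi> t x)) \<longlongrightarrow> 0) (at t)"
    and d: "((\<lambda>s. L2_inner (\<eta> t) (\<psi> s)) has_vector_derivative d) (at t)"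
  shows "((\<lambda>s. L2_inner (\<eta> s) (\<psi> s)) has_vector_derivative (L2_inner v (\<psi> t) + d)) (at t)"
proof -
  have "((\<lambda>s. L2_inner (\<lambda>x. of_real (1 / (s - t)) * (\<eta> s x - \<eta> t x)) (\<psi> s)
      + (1 / (s - t)) *\<^sub>R (L2_inner (\<eta> t) (\<psi> s) - L2_inner (\<eta> t) (\<psi> t)))
      \<longlongrightarrow> L2_inner v (\<psi> t) + d) (at t)"
    by (intro tendsto_add d[unfolded has_vector_derivative_iff_quotient] L2_inner_tendsto v \<psi> L2 L2_cmult L2_diff)
  moreover have "L2_inner (\<lambda>x. of_real (1 / (s - t)) * (\<eta> s x - \<eta> t x)) (\<psi> s)
      + (1 / (s - t)) *\<^sub>R (L2_inner (\<eta> t) (\<psi> s) - L2_inner (\<eta> t) (\<psi> t))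
      = (1 / (s - t)) *\<^sub>R (L2_inner (\<eta> s) (\<psi> s) - L2_inner (\<eta> t) (\<psi> t))" for s
    unfolding L2_inner_cmult_left L2_inner_diff_left[OF L2(1) L2(1) L2(2)] scaleR_conv_of_real
      complex_cnj_complex_of_real by (simp only: right_diff_distrib diff_add_eq diff_add_cancel add_diff_eq
        add_diff_cancel_right')
  ultimately show ?thesis
    unfolding has_vector_derivative_iff_quotient by simp
qed

lemma hamiltonian_L2:
  assumes \<eta>: "smooth \<eta>" and supp: "\<And>x. R < norm x \<Longrightarrow> \<eta> x = 0" and V: "continuous_on UNIV V"
  shows "hamiltonian V e \<eta> \<in> L2"
proof (rule L2_continuous_bounded_support)
  show "continuous_on UNIV (hamiltonian V e \<eta>)"
    unfolding hamiltonian_def[abs_def] laplacian_def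
    by (intro continuous_intros V smooth_continuous_on smooth_partials \<eta>)
  show "hamiltonian V e \<eta> x = 0" if "R < norm x" for x
    using partials_bounded_support[of R \<eta> x, OF supp that] supp[OF that]
    by (simp add: hamiltonian_def laplacian_def del: partials.simps)
qed

text \<open>
  At a point of continuity of the control the integrand of the weak equation is continuous: its
  dependence on the control is the term \<open>e \<bullet> x\<close>, bounded on the support of the test function. The
  derivative of the indefinite integral then exists there.
\<close>

lemma weak_solution_imp_derivative:
  fixes V :: "real^'n::finite \<Rightarrow> real"
  assumes sol: "weak_solution V E 0 \<psi>" and test: "test_function \<eta>"
    and supp: "\<And>x. R < norm x \<Longrightarrow> \<eta> x = 0" and V: "continuous_on UNIV V"
    and \<psi>: "\<And>s. \<psi> s \<in> L2" and cont: "((\<lambda>s. L2_norm (\<lambda>x. \<psi> s x - \<psi> t x)) \<longlongrightarrow> 0) (at t)"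
    and t: "0 < t" and E: "(E \<longlongrightarrow> E t) (at t)"
  shows "((\<lambda>s. L2_inner \<eta> (\<psi> s)) has_vector_derivative
    - \<i> * L2_inner (hamiltonian V (E t) \<eta>) (\<psi> t)) (at t)"
proof -
  have \<eta>: "smooth \<eta>" using test by (simp add: test_function_def)
  define u where "u \<tau> = L2_inner (hamiltonian V (E \<tau>) \<eta>) (\<psi> \<tau>)" for \<tau>
  note HL2 = hamiltonian_L2[OF \<eta> supp V]
  have xL2: "(\<lambda>x. of_real (norm x) * \<eta> x) \<in> L2"
  proof (rule L2_continuous_bounded_support)
    show "continuous_on UNIV (\<lambda>x. of_real (norm x) * \<eta> x)"
      by (rule continuous_on_mult[OF _ smooth_continuous_on[OF \<eta>]]) (intro continuous_intros)
    show "of_real (norm x) * \<eta> x = 0" if "R < norm x" for x using supp[OF that] by simp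
  qed
  have lim0: "((\<lambda>s. norm (E s - E t) * L2_norm (\<lambda>x. of_real (norm x) * \<eta> x)) \<longlongrightarrow> 0) (at t)"
    using tendsto_mult_left_zero[OF tendsto_norm_zero[OF LIM_zero[OF E]]] .
  have le: "L2_norm (\<lambda>x. hamiltonian V (E s) \<eta> x - hamiltonian V (E t) \<eta> x)
      \<le> norm (E s - E t) * L2_norm (\<lambda>x. of_real (norm x) * \<eta> x)" for s
  proof -
    have "L2_norm (\<lambda>x. hamiltonian V (E s) \<eta> x - hamiltonian V (E t) \<eta> x)
        \<le> L2_norm (\<lambda>x. of_real (norm (E s - E t)) * (of_real (norm x) * \<eta> x))"
    proof (rule L2_norm_mono)
      show "(\<lambda>x. of_real (norm (E s - E t)) * (of_real (norm x) * \<eta> x)) \<in> L2"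
        by (rule L2_cmult[OF xL2])
      show "(\<lambda>x. hamiltonian V (E s) \<eta> x - hamiltonian V (E t) \<eta> x) \<in> borel_measurable lborel"
        by (rule L2_measurable[OF L2_diff[OF HL2 HL2]])
      fix x
      have "hamiltonian V (E s) \<eta> x - hamiltonian V (E t) \<eta> x = - of_real ((E s - E t) \<bullet> x) * \<eta> x"
        by (simp add: hamiltonian_def inner_diff_left algebra_simps)
      then have "norm (hamiltonian V (E s) \<eta> x - hamiltonian V (E t) \<eta> x)
          = \<bar>(E s - E t) \<bullet> x\<bar> * norm (\<eta> x)" by (simp add: norm_mult)
      also have "\<dots> \<le> (norm (E s - E t) * norm x) * norm (\<eta> x)"
        by (intro mult_right_mono Cauchy_Schwarz_ineq2) simp
      finally show "norm (hamiltonian V (E s) \<eta> x - hamiltonian V (E t) \<eta> x)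
          \<le> norm (of_real (norm (E s - E t)) * (of_real (norm x) * \<eta> x))" by (simp add: norm_mult)
    qed
    then show ?thesis unfolding L2_norm_cmult by simp
  qed
  have H_cont: "((\<lambda>s. L2_norm (\<lambda>x. hamiltonian V (E s) \<eta> x - hamiltonian V (E t) \<eta> x)) \<longlongrightarrow> 0) (at t)"
    by (rule tendsto_sandwich[OF always_eventually[OF allI[OF L2_norm_nonneg]]
          always_eventually[OF allI[OF le]] tendsto_const lim0])
  have "(u \<longlongrightarrow> u t) (at t)"
    unfolding u_def by (rule L2_inner_tendsto[OF HL2 \<psi> HL2 \<psi> H_cont cont])
  then have u_cont: "continuous (at t within {0..t + 1}) u"
    unfolding continuous_within by (rule tendsto_within_subset) simp
  have w: "interval_lebesgue_integrable lborel (ereal 0) (ereal s) u \<and>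
      \<i> * (L2_inner \<eta> (\<psi> s) - L2_inner \<eta> (\<psi> 0)) = (LBINT \<tau>=ereal 0..ereal s. u \<tau>)" for s
    unfolding u_def by (rule sol[unfolded weak_solution_def, rule_format, OF test])
  have int: "set_integrable lborel {0<..<s} u" if "0 < s" for s
    using w[of s] that by (simp add: interval_lebesgue_integrable_def)
  have eq: "L2_inner \<eta> (\<psi> s) = L2_inner \<eta> (\<psi> 0) + (- \<i>) * integral {0..s} u" if s: "0 < s" for s
  proof -
    have I: "\<i> * (L2_inner \<eta> (\<psi> s) - L2_inner \<eta> (\<psi> 0)) = integral {0..s} u"
      using w[of s] s set_borel_integral_eq_integral(2)[OF int[OF s]]
      by (simp add: interval_lebesgue_integral_def integral_open_interval_real)
    show ?thesis unfolding I[symmetric] by simp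
  qed
  have "u integrable_on {0..t + 1}"
    unfolding integrable_on_Icc_iff_Ioo using set_borel_integral_eq_integral(1)[OF int[of "t + 1"]] t by simp
  from integral_has_vector_derivative_interior[OF this _ u_cont]
  have "((\<lambda>s. integral {0..s} u) has_vector_derivative u t) (at t)" using t by simp
  then have "((\<lambda>s. L2_inner \<eta> (\<psi> 0) + (- \<i>) * integral {0..s} u) has_vector_derivative 0 + (- \<i>) * u t) (at t)"
    by (intro has_vector_derivative_add has_vector_derivative_const
        bounded_linear.has_vector_derivative[OF bounded_linear_mult_right])
  then have "((\<lambda>s. L2_inner \<eta> (\<psi> s)) has_vector_derivative 0 + (- \<i>) * u t) (at t)"
    by (rule has_vector_derivative_transform_within_open[where S="{0<..}"]) (use t eq in auto)
  then show ?thesis by (simp add: u_def)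
qed

text \<open>
  The failure of a packet to solve the Schroedinger equation when its parameters obey
  \<open>q' = p\<close>, \<open>p' = e - a\<close> and the matching equation for the phase. The control \<open>e\<close> and the
  momentum cancel: what remains is the error of an affine approximation of \<open>V\<close> and the dispersion of
  the profile, which explains why all later bounds are uniform in the control.
\<close>

lemma packet_residual:
  fixes V :: "real^'n::finite \<Rightarrow> real"
  assumes g: "smooth g"
  shows "\<i> * packet_velocity g \<theta> p q (- (p \<bullet> p) / 2 - V q + a \<bullet> q) (e - a) p x
      - hamiltonian V e (packet g \<theta> p q) x
    = of_real (V q - V x + a \<bullet> (x - q)) * packet g \<theta> p q x
      + (1 / 2) * packet (\<lambda>y. \<Sum>i\<in>UNIV. partials [i, i] g y) \<theta> p q x"
  unfolding packet_velocity_def hamiltonian_def laplacian_packet[OF g]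
  by (simp add: algebra_simps inner_diff_left inner_diff_right del: partials.simps)

text \<open>
  Complex valued only so that its size can be measured by \<open>L2_norm\<close>.
\<close>

definition residual_bound :: "real \<Rightarrow> (real^'n::finite \<Rightarrow> real) \<Rightarrow> real^'n \<Rightarrow> complex" where
  "residual_bound M g y = of_real (M * (norm y + 1) * norm y * \<bar>g y\<bar>
     + (1 / 2) * \<bar>\<Sum>i\<in>UNIV. partials [i, i] g y\<bar>)"

lemma residual_bound_L2:
  assumes g: "smooth g" and supp: "\<And>y. R < norm y \<Longrightarrow> g y = 0"
  shows "residual_bound M g \<in> L2"
proof (rule L2_continuous_bounded_support)
  show "continuous_on UNIV (residual_bound M g)"
    unfolding residual_bound_def[abs_def]
    by (intro continuous_intros smooth_continuous_on smooth_partials g)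
  show "residual_bound M g y = 0" if "R < norm y" for y
    using partials_bounded_support[of R g y, OF supp that] supp[OF that]
    by (simp add: residual_bound_def del: partials.simps)
qed

lemma packet_residual_le:
  fixes V :: "real^'n::finite \<Rightarrow> real"
  assumes V: "admissible_potential V" and r: "norm (r - q) \<le> 1"
  shows "norm (of_real (V q - V x + gradient V r \<bullet> (x - q)) * packet g \<theta> p q x
      + (1 / 2) * packet (\<lambda>y. \<Sum>i\<in>UNIV. partials [i, i] g y) \<theta> p q x)
    \<le> norm (residual_bound (hessian_sup_norm V) g (x - q))"
proof -
  let ?A = "\<bar>V q - V x + gradient V r \<bullet> (x - q)\<bar>"
  let ?B = "hessian_sup_norm V * (norm (x - q) + 1) * norm (x - q)"
  let ?D = "\<bar>\<Sum>i\<in>UNIV. partials [i, i] g (x - q)\<bar>"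
  have "norm (of_real (V q - V x + gradient V r \<bullet> (x - q)) * packet g \<theta> p q x
      + (1 / 2) * packet (\<lambda>y. \<Sum>i\<in>UNIV. partials [i, i] g y) \<theta> p q x)
    \<le> ?A * \<bar>g (x - q)\<bar> + (1 / 2) * ?D"
    by (rule norm_triangle_le) (simp add: norm_mult norm_packet del: of_real_add of_real_diff partials.simps)
  also have "\<dots> \<le> ?B * \<bar>g (x - q)\<bar> + (1 / 2) * ?D"
    by (intro add_right_mono mult_right_mono affine_approximation_error[OF V r]) simp
  also have "\<dots> \<le> norm (residual_bound (hessian_sup_norm V) g (x - q))"
    unfolding residual_bound_def norm_of_real by (rule abs_ge_self)
  finally show ?thesis .
qed

text \<open>
  The packet follows an approximate classical trajectory that starts with the data of the initial
  state. Off the finitely many jumps of the control the overlap \<open>\<langle>\<eta>, \<psi>\<rangle>\<close> has derivative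
  \<open>\<i> \<langle>r, \<psi>\<rangle>\<close>, where \<open>r\<close> is the residual of the packet; the unbounded Hamiltonian has dropped out.
  Cauchy--Schwarz bounds this derivative by a constant that depends on \<open>V\<close> only through the bound on
  its Hessian.
\<close>

lemma overlap_drift:
  fixes V g :: "real^'n::finite \<Rightarrow> real"
  assumes V: "admissible_potential V" and g: "smooth g" and supp: "\<And>y. R < norm y \<Longrightarrow> g y = 0"
    and T: "0 \<le> T" "hessian_sup_norm V * T\<^sup>2 \<le> 1 / 2" and E: "piecewise_continuous 0 T E"
    and \<psi>L2: "\<And>s. \<psi> s \<in> L2" and \<psi>norm: "\<And>s. L2_norm (\<psi> s) = 1"
    and cont: "\<And>t. ((\<lambda>s. L2_norm (\<lambda>x. \<psi> s x - \<psi> t x)) \<longlongrightarrow> 0) (at t)"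
    and sol: "weak_solution V (\<lambda>t. if t \<in> {0..T} then E t else 0) 0 \<psi>"
    and t: "t \<in> {0..T}"
  shows "\<exists>\<theta> p q. norm (L2_inner (packet g \<theta> p q) (\<psi> t)
      - L2_inner (packet g (- (v0 \<bullet> x0)) v0 x0) (\<psi> 0))
    \<le> L2_norm (residual_bound (hessian_sup_norm V) g) * t"
proof -
  let ?M = "hessian_sup_norm V"
  let ?E = "\<lambda>t. if t \<in> {0..T} then E t else 0"
  let ?K = "L2_norm (residual_bound ?M g)"
  have smV: "smooth V" using V by (simp add: admissible_potential_def)
  note contV = smooth_continuous_on[OF smV, of UNIV]
  obtain F where F: "finite F" "\<And>t. t \<in> {0..T} - F \<Longrightarrow> continuous (at t within {0..T}) E"
    using E unfolding piecewise_continuous_def by blast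
  obtain p q r where pqr: "continuous_on {0..T} p" "continuous_on {0..T} q" "continuous_on {0..T} r"
    "p 0 = v0" "q 0 = x0" "\<And>t. t \<in> {0..T} \<Longrightarrow> norm (r t - q t) \<le> 1"
    and p': "\<And>t. t \<in> {0<..<T} \<Longrightarrow> continuous (at t within {0..T}) E \<Longrightarrow>
       (p has_vector_derivative E t - gradient V (r t)) (at t)"
    and q': "\<And>t. t \<in> {0<..<T} \<Longrightarrow> (q has_vector_derivative p t) (at t)"
    by (rule approximate_trajectory[OF T(1) piecewise_continuous_integrable[OF E] gradient_lipschitz[OF V]
          hessian_sup_norm_bound(2)[OF V] T(2), where ?v0.0=v0 and ?x0.0=x0]) blast
  \<comment> \<open>The force is evaluated along \<open>r\<close>, the momentum and the potential along the trajectory itself.\<close>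
  define d\<theta> where "d\<theta> s = - (p s \<bullet> p s) / 2 - V (q s) + gradient V (r s) \<bullet> q s" for s
  define \<theta> where "\<theta> s = - (v0 \<bullet> x0) + integral {0..s} d\<theta>" for s
  have grad_cont: "continuous_on UNIV (gradient V)"
  proof (rule lipschitz_on_continuous_on)
    show "?M-lipschitz_on UNIV (gradient V)"
      using gradient_lipschitz[OF V] hessian_sup_norm_bound(2)[OF V]
      by (auto intro!: lipschitz_onI simp: dist_norm)
  qed
  have d\<theta>_cont: "continuous_on {0..T} d\<theta>"
    unfolding d\<theta>_def[abs_def]
    by (intro continuous_on_add continuous_on_diff continuous_on_divide continuous_on_minus
        continuous_on_inner continuous_on_const pqr(1-3) continuous_on_compose2[OF contV pqr(2)]
        continuous_on_compose2[OF grad_cont pqr(3)]) auto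
  have \<theta>_cont: "continuous_on {0..T} \<theta>"
    unfolding \<theta>_def[abs_def]
    by (intro continuous_on_add continuous_on_const indefinite_integral_continuous_1
        integrable_continuous_real d\<theta>_cont)
  have \<theta>': "(\<theta> has_vector_derivative d\<theta> s) (at s)" if s: "s \<in> {0<..<T}" for s
  proof -
    have "continuous (at s within {0..T}) d\<theta>"
      using d\<theta>_cont s by (auto simp: continuous_on_eq_continuous_within)
    from integral_has_vector_derivative_interior[OF integrable_continuous_real[OF d\<theta>_cont] s this]
    have "((\<lambda>s. - (v0 \<bullet> x0) + integral {0..s} d\<theta>) has_vector_derivative 0 + d\<theta> s) (at s)"
      by (intro has_vector_derivative_add has_vector_derivative_const)
    then show ?thesis by (simp add: \<theta>_def[abs_def])
  qed
  define \<eta> where "\<eta> s = packet g (\<theta> s) (p s) (q s)" for s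
  define f where "f s = L2_inner (\<eta> s) (\<psi> s)" for s
  have \<eta>L2: "\<eta> s \<in> L2" for s unfolding \<eta>_def by (rule packet_L2[OF g supp])
  have f_cont: "continuous_on {0..t} f"
  proof (rule continuous_on_subset)
    show "continuous_on {0..T} f"
      unfolding continuous_on_def
    proof
      fix s assume s: "s \<in> {0..T}"
      have "((\<lambda>s'. L2_norm (\<lambda>x. \<eta> s' x - \<eta> s x)) \<longlongrightarrow> 0) (at s within {0..T})"
        unfolding \<eta>_def
        by (rule packet_L2_continuous[OF g supp])
          (use s \<theta>_cont pqr(1,2) in \<open>auto simp: continuous_on_def\<close>)
      then show "(f \<longlongrightarrow> f s) (at s within {0..T})"
        unfolding f_def
        by (intro L2_inner_tendsto \<eta>L2 \<psi>L2 tendsto_within_subset[OF cont subset_UNIV])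
    qed
  qed (use t in auto)
  define r' where "r' s x = of_real (V (q s) - V x + gradient V (r s) \<bullet> (x - q s)) * packet g (\<theta> s) (p s) (q s) x
      + (1 / 2) * packet (\<lambda>y. \<Sum>i\<in>UNIV. partials [i, i] g y) (\<theta> s) (p s) (q s) x" for s x
  have f': "(f has_vector_derivative \<i> * L2_inner (r' s) (\<psi> s)) (at s)
      \<and> norm (\<i> * L2_inner (r' s) (\<psi> s)) \<le> ?K"
    if s: "s \<in> {0<..<t} - F" for s
  proof -
    have s': "s \<in> {0<..<T}" "s \<in> {0..T}" "s \<in> {0..T} - F" "0 < s" using s t by auto
    note Es = F(2)[OF s'(3)]
    let ?v = "packet_velocity g (\<theta> s) (p s) (q s) (d\<theta> s) (E s - gradient V (r s)) (p s)"
    let ?H = "hamiltonian V (E s) (\<eta> s)"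
    note L2der = packet_L2_derivative[OF g supp \<theta>'[OF s'(1)] p'[OF s'(1) Es] q'[OF s'(1)]]
    have "(E \<longlongrightarrow> E s) (at s)"
      using Es s'(1) by (simp add: continuous_within at_within_Icc_at)
    moreover have "\<forall>\<^sub>F u in at s. ?E u = E u"
      using eventually_at_in_open'[of "{0<..<T}" s] s'(1) by (auto elim!: eventually_mono)
    ultimately have Elim: "(?E \<longlongrightarrow> ?E s) (at s)"
      using s'(2) by (simp add: tendsto_cong)
    have \<eta>supp: "\<eta> s x = 0" if "R + norm (q s) < norm x" for x
      using supp[of "x - q s"] norm_triangle_ineq2[of x "q s"] that by (simp add: \<eta>_def packet_def)
    have test: "test_function (\<eta> s)" unfolding \<eta>_def by (rule test_function_packet[OF g supp])
    have sm: "smooth (\<eta> s)" unfolding \<eta>_def by (rule smooth_packet[OF g])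
    have "((\<lambda>u. L2_inner (\<eta> s) (\<psi> u)) has_vector_derivative
        - \<i> * L2_inner (hamiltonian V (?E s) (\<eta> s)) (\<psi> s)) (at s)"
      by (rule weak_solution_imp_derivative[OF sol test \<eta>supp contV \<psi>L2 cont s'(4) Elim])
    then have w: "((\<lambda>u. L2_inner (\<eta> s) (\<psi> u)) has_vector_derivative - \<i> * L2_inner ?H (\<psi> s)) (at s)"
      using s'(2) by simp
    have der: "(f has_vector_derivative L2_inner ?v (\<psi> s) + - \<i> * L2_inner ?H (\<psi> s)) (at s)"
      unfolding f_def
      by (rule L2_inner_has_vector_derivative[OF \<eta>L2 \<psi>L2 L2der(1) L2der(2)[folded \<eta>_def] cont w])
    have HL2: "?H \<in> L2" by (rule hamiltonian_L2[OF sm \<eta>supp contV])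
    have rv: "r' s = (\<lambda>x. \<i> * ?v x - ?H x)"
      unfolding r'_def \<eta>_def d\<theta>_def packet_residual[OF g] ..
    have "L2_inner (r' s) (\<psi> s) = - \<i> * L2_inner ?v (\<psi> s) - L2_inner ?H (\<psi> s)"
    proof -
      have "L2_inner (r' s) (\<psi> s) = L2_inner (\<lambda>x. \<i> * ?v x) (\<psi> s) - L2_inner ?H (\<psi> s)"
        unfolding rv by (rule L2_inner_diff_left[OF L2_cmult[OF L2der(1)] HL2 \<psi>L2])
      then show ?thesis unfolding L2_inner_cmult_left by simp
    qed
    then have eq: "\<i> * L2_inner (r' s) (\<psi> s) = L2_inner ?v (\<psi> s) + - \<i> * L2_inner ?H (\<psi> s)"
      by (simp add: right_diff_distrib)
    have r'L2: "r' s \<in> L2" unfolding rv by (intro L2_diff L2_cmult L2der(1) HL2)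
    have res: "residual_bound ?M g \<in> L2" by (rule residual_bound_L2[OF g supp])
    have "norm (L2_inner (r' s) (\<psi> s)) \<le> L2_norm (r' s) * L2_norm (\<psi> s)"
      by (rule L2_inner_Cauchy_Schwarz[OF r'L2 \<psi>L2])
    also have "\<dots> = L2_norm (r' s)" by (simp add: \<psi>norm)
    also have "\<dots> \<le> L2_norm (\<lambda>x. residual_bound ?M g (x - q s))"
      by (rule L2_norm_mono[OF L2_translate[OF res] L2_measurable[OF r'L2]])
        (unfold r'_def, rule packet_residual_le[OF V pqr(6)[OF s'(2)]])
    also have "\<dots> = ?K" by (rule L2_norm_translate[OF L2_measurable[OF res]])
    finally show ?thesis using der unfolding eq[symmetric] by (simp add: norm_mult)
  qed
  have "((\<lambda>s. \<i> * L2_inner (r' s) (\<psi> s)) has_integral (f t - f 0)) {0..t}"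
    by (rule fundamental_theorem_of_calculus_interior_strong[OF F(1)])
      (use t f' f_cont in auto)
  then have "norm (f t - f 0) \<le> ?K * measure lborel (cbox 0 t)"
    by (intro has_integral_bound_spike_finite[where S="F \<union> {0, t}" and f="\<lambda>s. \<i> * L2_inner (r' s) (\<psi> s)"])
      (use f' F(1) L2_norm_nonneg in auto)
  then have "norm (f t - f 0) \<le> ?K * t" using t by simp
  moreover have "f 0 = L2_inner (packet g (- (v0 \<bullet> x0)) v0 x0) (\<psi> 0)"
    by (simp add: f_def \<eta>_def \<theta>_def pqr)
  ultimately show ?thesis unfolding f_def \<eta>_def by metis
qed

text \<open>
  Both the solution and the packet keep their norms, so the squared distance between them changes
  only through the overlap, hence by at most twice its drift. Exchanging the truncated profile for
  the Gaussian costs \<open>\<epsilon>\<close> at the initial time and once more at time \<open>t\<close>.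
\<close>

lemma solution_near_gaussian_packets:
  fixes V g :: "real^'n::finite \<Rightarrow> real"
  assumes V: "admissible_potential V" and b: "0 < b"
    and g: "smooth g" and supp: "\<And>y. R < norm y \<Longrightarrow> g y = 0"
    and T: "0 \<le> T" "hessian_sup_norm V * T\<^sup>2 \<le> 1 / 2" and E: "piecewise_continuous 0 T E"
    and U: "schroedinger_propagator V (\<lambda>t. if t \<in> {0..T} then E t else 0) U"
    and t: "t \<in> {0..T}"
  defines "\<epsilon> \<equiv> L2_norm (\<lambda>y. of_real (g y) - of_real (gauss b y))"
  shows "\<exists>\<theta> p q. L2_norm (\<lambda>x. U t 0 (gaussian_state b x0 v0) x - packet (gauss b) \<theta> p q x)
    \<le> \<epsilon> + sqrt (\<epsilon>\<^sup>2 + 2 * L2_norm (residual_bound (hessian_sup_norm V) g) * t)"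
proof -
  let ?K = "L2_norm (residual_bound (hessian_sup_norm V) g)"
  let ?\<psi>0 = "gaussian_state b x0 v0"
  define \<psi> where "\<psi> s = U s 0 ?\<psi>0" for s
  note \<psi>0 = gaussian_state_L2[OF b, of x0 v0]
  have unitary: "unitary_operator (U s 0)" for s using U by (simp add: schroedinger_propagator_def)
  have \<psi>L2: "\<psi> s \<in> L2" for s using unitary[of s] \<psi>0(1) by (simp add: unitary_operator_def \<psi>_def)
  have \<psi>norm: "L2_norm (\<psi> s) = 1" for s
  proof -
    have "L2_inner (\<psi> s) (\<psi> s) = L2_inner ?\<psi>0 ?\<psi>0"
      using unitary[of s] \<psi>0(1) by (simp add: unitary_operator_def \<psi>_def)
    then have "(L2_norm (\<psi> s))\<^sup>2 = (L2_norm ?\<psi>0)\<^sup>2" unfolding L2_inner_self of_real_eq_iff .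
    then show ?thesis using \<psi>0(2) L2_norm_nonneg[of "\<psi> s"] by (simp add: power2_eq_1_iff)
  qed
  have cont: "((\<lambda>s. L2_norm (\<lambda>x. \<psi> s x - \<psi> u x)) \<longlongrightarrow> 0) (at u)" for u
  proof -
    have "((\<lambda>(t', s'). L2_norm (\<lambda>x. U t' s' ?\<psi>0 x - U u 0 ?\<psi>0 x)) \<longlongrightarrow> 0) (at (u, 0))"
      using U \<psi>0(1) by (simp add: schroedinger_propagator_def)
    moreover have "filterlim (\<lambda>s. (s, 0::real)) (at (u, 0)) (at u)"
      unfolding filterlim_at by (auto intro!: tendsto_intros simp: eventually_at_filter)
    ultimately have "((\<lambda>s. case (s, 0::real) of (t', s') \<Rightarrow> L2_norm (\<lambda>x. U t' s' ?\<psi>0 x - U u 0 ?\<psi>0 x)) \<longlongrightarrow> 0) (at u)"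
      by (rule filterlim_compose)
    then show ?thesis by (simp add: \<psi>_def)
  qed
  have sol: "weak_solution V (\<lambda>t. if t \<in> {0..T} then E t else 0) 0 \<psi>"
    unfolding \<psi>_def using U \<psi>0(1) by (simp add: schroedinger_propagator_def)
  obtain \<theta> p q where drift: "norm (L2_inner (packet g \<theta> p q) (\<psi> t)
      - L2_inner (packet g (- (v0 \<bullet> x0)) v0 x0) (\<psi> 0)) \<le> ?K * t"
    using overlap_drift[OF V g supp T E \<psi>L2 \<psi>norm cont sol t] by blast
  let ?\<eta>t = "packet g \<theta> p q" and ?\<eta>0 = "packet g (- (v0 \<bullet> x0)) v0 x0"
  have \<eta>L2: "packet g \<theta> p q \<in> L2" for \<theta> p q by (rule packet_L2[OF g supp])
  have gm[measurable]: "g \<in> borel_measurable borel"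
    by (rule borel_measurable_continuous_onI[OF smooth_continuous_on[OF g]])
  have diff: "L2_norm (\<lambda>x. packet g \<theta> p q x - packet (gauss b) \<theta> p q x) = \<epsilon>" for \<theta> p q
  proof -
    have "L2_norm (\<lambda>x. packet g \<theta> p q x - packet (gauss b) \<theta> p q x)
        = L2_norm (packet (\<lambda>y. g y - gauss b y) \<theta> p q)"
      unfolding packet_def[abs_def] of_real_diff right_diff_distrib ..
    also have "\<dots> = \<epsilon>" unfolding \<epsilon>_def by (subst L2_norm_packet) simp_all
    finally show ?thesis .
  qed
  have "L2_eq (\<psi> 0) ?\<psi>0" unfolding \<psi>_def using U \<psi>0(1) by (simp add: schroedinger_propagator_def)
  then have "L2_norm (\<lambda>x. ?\<eta>0 x - \<psi> 0 x) = L2_norm (\<lambda>x. ?\<eta>0 x - ?\<psi>0 x)"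
    unfolding L2_eq_def by (intro L2_norm_cong_AE L2_measurable L2_diff \<eta>L2 \<psi>L2 \<psi>0) (auto elim!: eventually_mono)
  also have "\<dots> = \<epsilon>" unfolding gaussian_state_eq_packet by (rule diff)
  finally have start: "L2_norm (\<lambda>x. ?\<eta>0 x - \<psi> 0 x) = \<epsilon>" .
  have "(L2_norm (\<lambda>x. ?\<eta>t x - \<psi> t x))\<^sup>2
      = (L2_norm ?\<eta>t)\<^sup>2 + 1 - 2 * Re (L2_inner ?\<eta>t (\<psi> t))"
    unfolding L2_norm_diff_power2[OF \<eta>L2 \<psi>L2] \<psi>norm by simp
  also have "\<dots> \<le> (L2_norm ?\<eta>0)\<^sup>2 + 1 - 2 * Re (L2_inner ?\<eta>0 (\<psi> 0)) + 2 * ?K * t"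
    using drift abs_Re_le_cmod[of "L2_inner ?\<eta>t (\<psi> t) - L2_inner ?\<eta>0 (\<psi> 0)"]
    unfolding L2_norm_packet[OF gm] by simp
  also have "(L2_norm ?\<eta>0)\<^sup>2 + 1 - 2 * Re (L2_inner ?\<eta>0 (\<psi> 0)) = \<epsilon>\<^sup>2"
    unfolding start[symmetric] L2_norm_diff_power2[OF \<eta>L2 \<psi>L2] \<psi>norm by simp
  finally have near: "L2_norm (\<lambda>x. ?\<eta>t x - \<psi> t x) \<le> sqrt (\<epsilon>\<^sup>2 + 2 * ?K * t)"
    by (rule real_le_rsqrt)
  have "L2_norm (\<lambda>x. \<psi> t x - packet (gauss b) \<theta> p q x)
      \<le> L2_norm (\<lambda>x. \<psi> t x - ?\<eta>t x) + L2_norm (\<lambda>x. ?\<eta>t x - packet (gauss b) \<theta> p q x)"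
    by (rule L2_dist_triangle[OF \<psi>L2 \<eta>L2 packet_gauss_L2[OF b]])
  also have "\<dots> \<le> sqrt (\<epsilon>\<^sup>2 + 2 * ?K * t) + \<epsilon>"
    unfolding diff L2_norm_minus_commute[of "\<psi> t"] using near by simp
  finally show ?thesis unfolding \<psi>_def by (auto simp: add.commute)
qed

section \<open>Separation from non-Gaussian states\<close>

text \<open>
  At distance at least \<open>d\<close> from all states whose modulus is a translate of the initial one, the target
  cannot be approached to \<open>d/2\<close> by a solution that stays within \<open>3d/8\<close> of those states. The profile is
  chosen first, from \<open>b\<close> and the target; the time is chosen afterwards, so small that the drift of the
  overlap with this profile is negligible.
\<close>

lemma uniform_separation:
  fixes \<psi>f :: "real^'n::finite \<Rightarrow> complex"
  assumes b: "0 < b" and \<psi>f: "\<psi>f \<in> L2_sphere" and np: "\<not> has_gaussian_profile \<psi>f"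
  shows "\<exists>\<delta>>0. \<forall>M\<ge>0. \<exists>T>0. \<forall>V x0 v0 E U t.
    admissible_potential V \<longrightarrow> hessian_sup_norm V = M \<longrightarrow> piecewise_continuous 0 T E \<longrightarrow>
    schroedinger_propagator V (\<lambda>t. if t \<in> {0..T} then E t else 0) U \<longrightarrow> t \<in> {0..T} \<longrightarrow>
    \<delta> < L2_norm (\<lambda>x. U t 0 (gaussian_state b x0 v0) x - \<psi>f x)"
proof -
  have \<psi>L2: "\<psi>f \<in> L2" using \<psi>f by (simp add: L2_sphere_def)
  note [measurable] = L2_measurable[OF \<psi>L2]
  obtain d where d: "d > 0"
    "\<And>\<gamma>. d \<le> L2_norm (\<lambda>x. of_real (gauss b (x - \<gamma>)) - of_real (norm (\<psi>f x)))"
    using positive_distance_to_gauss_translates[OF b \<psi>L2 np] by blast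
  obtain g :: "real^'n \<Rightarrow> real" and R where g: "smooth g" and supp': "\<And>y. R \<le> norm y \<Longrightarrow> g y = 0"
    and \<epsilon>: "L2_norm (\<lambda>y. of_real (g y) - of_real (gauss b y)) < d / 8"
    using smooth_compact_support_approximation_of_gauss[OF b, of "d / 8"] d(1) by auto
  have supp: "g y = 0" if "R < norm y" for y using supp' that by simp
  define \<epsilon> where "\<epsilon> = L2_norm (\<lambda>y. complex_of_real (g y) - of_real (gauss b y))"
  have \<epsilon>: "0 \<le> \<epsilon>" "\<epsilon> < d / 8" using \<epsilon> by (auto simp: \<epsilon>_def L2_norm_nonneg)
  have "\<exists>T>0. \<forall>V x0 v0 E U t.
    admissible_potential V \<longrightarrow> hessian_sup_norm V = M \<longrightarrow> piecewise_continuous 0 T E \<longrightarrow>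
    schroedinger_propagator V (\<lambda>t. if t \<in> {0..T} then E t else 0) U \<longrightarrow> t \<in> {0..T} \<longrightarrow>
    d / 2 < L2_norm (\<lambda>x. U t 0 (gaussian_state b x0 v0) x - \<psi>f x)" if M: "M \<ge> 0" for M
  proof -
    define K where "K = L2_norm (residual_bound M g)"
    \<comment> \<open>The first two terms of the minimum give \<open>M T\<^sup>2 \<le> 1/2\<close>, which the trajectory needs; the third
      keeps the drift \<open>2 K T\<close> of the squared distance below \<open>(d/8)\<^sup>2\<close>.\<close>
    have K: "0 \<le> K" by (simp add: K_def L2_norm_nonneg)
    define T where "T = min (min 1 (1 / (2 * M + 2))) ((d / 8)\<^sup>2 / (2 * K + 1))"
    have T0: "0 < T" using M K d(1) by (simp add: T_def)
    have "T \<le> 1" by (simp add: T_def)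
    then have "T\<^sup>2 \<le> T" using T0 by (simp add: power2_eq_square mult_left_le)
    then have "M * T\<^sup>2 \<le> M * T" using M by (intro mult_left_mono)
    also have "\<dots> \<le> M * (1 / (2 * M + 2))" using M by (intro mult_left_mono) (simp_all add: T_def)
    also have "\<dots> \<le> 1 / 2" using M by (simp add: field_simps)
    finally have MT: "M * T\<^sup>2 \<le> 1 / 2" .
    have "2 * K * T \<le> (2 * K + 1) * T" using T0 by (simp add: distrib_right)
    also have "\<dots> \<le> (2 * K + 1) * ((d / 8)\<^sup>2 / (2 * K + 1))"
      using K by (intro mult_left_mono) (simp_all add: T_def)
    also have "\<dots> = (d / 8)\<^sup>2" using K by simp
    finally have KT: "2 * K * T \<le> (d / 8)\<^sup>2" .
    have "d / 2 < L2_norm (\<lambda>x. U t 0 (gaussian_state b x0 v0) x - \<psi>f x)"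
      if V: "admissible_potential V" "hessian_sup_norm V = M" and E: "piecewise_continuous 0 T E"
        and U: "schroedinger_propagator V (\<lambda>t. if t \<in> {0..T} then E t else 0) U" and t: "t \<in> {0..T}"
      for V x0 v0 E U t
    proof -
      let ?\<psi> = "U t 0 (gaussian_state b x0 v0)"
      obtain \<theta> p q where near: "L2_norm (\<lambda>x. ?\<psi> x - packet (gauss b) \<theta> p q x) \<le> \<epsilon> + sqrt (\<epsilon>\<^sup>2 + 2 * K * t)"
        using solution_near_gaussian_packets[OF V(1) b g supp less_imp_le[OF T0] MT[folded V(2)] E U t]
        unfolding \<epsilon>_def K_def V(2) by blast
      have "2 * K * t \<le> 2 * K * T" using t K by (intro mult_left_mono) auto
      moreover have "\<epsilon>\<^sup>2 \<le> (d / 8)\<^sup>2" using \<epsilon> by (intro power_mono) auto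
      ultimately have "\<epsilon>\<^sup>2 + 2 * K * t \<le> (d / 8)\<^sup>2 + (d / 8)\<^sup>2" using KT by linarith
      also have "\<dots> \<le> (d / 4)\<^sup>2" by (simp add: power2_eq_square)
      finally have "\<epsilon>\<^sup>2 + 2 * K * t \<le> (d / 4)\<^sup>2" .
      then have "sqrt (\<epsilon>\<^sup>2 + 2 * K * t) \<le> d / 4" using d(1) by (intro real_le_lsqrt) auto
      with near \<epsilon> have near': "L2_norm (\<lambda>x. ?\<psi> x - packet (gauss b) \<theta> p q x) < d / 2"
        using d(1) by linarith
      have \<psi>tL2: "?\<psi> \<in> L2"
      proof -
        have "unitary_operator (U t 0)" using U by (simp add: schroedinger_propagator_def)
        then show ?thesis by (simp add: unitary_operator_def gaussian_state_L2(1)[OF b])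
      qed
      have "d \<le> L2_norm (\<lambda>x. of_real (norm (packet (gauss b) \<theta> p q x)) - of_real (norm (\<psi>f x)))"
        using d(2)[of q] by (simp add: norm_packet gauss_nonneg)
      also have "\<dots> \<le> L2_norm (\<lambda>x. packet (gauss b) \<theta> p q x - \<psi>f x)"
        by (rule L2_dist_modulus_le[OF packet_gauss_L2[OF b] \<psi>L2])
      also have "\<dots> \<le> L2_norm (\<lambda>x. packet (gauss b) \<theta> p q x - ?\<psi> x) + L2_norm (\<lambda>x. ?\<psi> x - \<psi>f x)"
        by (rule L2_dist_triangle[OF packet_gauss_L2[OF b] \<psi>tL2 \<psi>L2])
      finally show ?thesis
        using near' by (subst (asm) L2_norm_minus_commute) linarith
    qed
    then show ?thesis using T0 by blast
  qed
  then show ?thesis using d(1) by (intro exI[of _ "d / 2"]) simp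
qed

theorem theorem2:
  "\<exists>(T :: real \<Rightarrow> real \<Rightarrow> real \<Rightarrow> (real^'n::finite \<Rightarrow> complex) \<Rightarrow> real)
    (\<delta> :: real \<Rightarrow> real \<Rightarrow> (real^'n \<Rightarrow> complex) \<Rightarrow> real).
    \<forall>(V :: real^'n \<Rightarrow> real) (b :: real) (x0 :: real^'n) (v0 :: real^'n)
     (\<psi>f :: real^'n \<Rightarrow> complex).
      admissible_potential V \<longrightarrow> 0 < b \<longrightarrow>
      \<psi>f \<in> L2_sphere \<longrightarrow> \<not> has_gaussian_profile \<psi>f \<longrightarrow>
      (let Tss = T (hessian_sup_norm V) (third_derivative_sup_norm V) b \<psi>f;
           d = \<delta> (hessian_sup_norm V) b \<psi>f
       in 0 < Tss \<and> 0 < d \<and>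
          (\<forall>(E :: real \<Rightarrow> real^'n) U.
             piecewise_continuous 0 Tss E \<longrightarrow>
             schroedinger_propagator V (\<lambda>t. if t \<in> {0..Tss} then E t else 0) U \<longrightarrow>
             (\<forall>t\<in>{0..Tss}. d < L2_norm (\<lambda>x. U t 0 (gaussian_state b x0 v0) x - \<psi>f x))))"
proof -
  define separates :: "real \<Rightarrow> real \<Rightarrow> real \<Rightarrow> (real^'n \<Rightarrow> complex) \<Rightarrow> real \<Rightarrow> bool" where
    "separates M T b \<psi>f \<delta> \<longleftrightarrow> (\<forall>V x0 v0 E U t.
      admissible_potential V \<longrightarrow> hessian_sup_norm V = M \<longrightarrow> piecewise_continuous 0 T E \<longrightarrow>
      schroedinger_propagator V (\<lambda>t. if t \<in> {0..T} then E t else 0) U \<longrightarrow> t \<in> {0..T} \<longrightarrow>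
      \<delta> < L2_norm (\<lambda>x. U t 0 (gaussian_state b x0 v0) x - \<psi>f x))" for M T b \<psi>f \<delta>
  have "\<exists>\<delta>. 0 < \<delta> \<and> (\<forall>M\<ge>0. \<exists>T>0. separates M T b \<psi>f \<delta>)"
    if "0 < b" "\<psi>f \<in> L2_sphere" "\<not> has_gaussian_profile \<psi>f" for b \<psi>f
    using uniform_separation[OF that] unfolding separates_def .
  then obtain \<delta> where \<delta>: "\<And>b \<psi>f. 0 < b \<Longrightarrow> \<psi>f \<in> L2_sphere \<Longrightarrow> \<not> has_gaussian_profile \<psi>f \<Longrightarrow>
      0 < \<delta> b \<psi>f \<and> (\<forall>M\<ge>0. \<exists>T>0. separates M T b \<psi>f (\<delta> b \<psi>f))"
    by metis
  \<comment> \<open>The time is a function of the norm of the Hessian, so it is chosen before \<open>V\<close> is.\<close>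
  define T where "T M b \<psi>f = (SOME T. 0 < T \<and> separates M T b \<psi>f (\<delta> b \<psi>f))" for M b \<psi>f
  have T: "0 < T M b \<psi>f \<and> separates M (T M b \<psi>f) b \<psi>f (\<delta> b \<psi>f)"
    if "0 < b" "\<psi>f \<in> L2_sphere" "\<not> has_gaussian_profile \<psi>f" "0 \<le> M" for M b \<psi>f
    unfolding T_def by (rule someI_ex) (use \<delta>[OF that(1-3)] that(4) in blast)
  show ?thesis
    unfolding Let_def
  proof (rule exI[of _ "\<lambda>M M3 b \<psi>f. T M b \<psi>f"], rule exI[of _ "\<lambda>M b \<psi>f. \<delta> b \<psi>f"], intro allI impI)
    fix V :: "real^'n \<Rightarrow> real" and b :: real and x0 v0 :: "real^'n" and \<psi>f :: "real^'n \<Rightarrow> complex"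
    assume V: "admissible_potential V" and h: "0 < b" "\<psi>f \<in> L2_sphere" "\<not> has_gaussian_profile \<psi>f"
    have s: "0 < T (hessian_sup_norm V) b \<psi>f"
      "separates (hessian_sup_norm V) (T (hessian_sup_norm V) b \<psi>f) b \<psi>f (\<delta> b \<psi>f)"
      using T[OF h hessian_sup_norm_bound(2)[OF V]] by auto
    show "0 < T (hessian_sup_norm V) b \<psi>f \<and> 0 < \<delta> b \<psi>f \<and>
        (\<forall>(E :: real \<Rightarrow> real^'n) U.
           piecewise_continuous 0 (T (hessian_sup_norm V) b \<psi>f) E \<longrightarrow>
           schroedinger_propagator V (\<lambda>t. if t \<in> {0..T (hessian_sup_norm V) b \<psi>f} then E t else 0) U \<longrightarrow>
           (\<forall>t\<in>{0..T (hessian_sup_norm V) b \<psi>f}.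
              \<delta> b \<psi>f < L2_norm (\<lambda>x. U t 0 (gaussian_state b x0 v0) x - \<psi>f x)))"
    proof (intro conjI allI impI ballI)
      show "0 < \<delta> b \<psi>f" using \<delta>[OF h] by (rule conjunct1)
    qed (fact s(1), rule s(2)[unfolded separates_def, rule_format, OF V refl])
  qed
qed

end
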